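(* Let $f$ be a Stieltjes function, or a function of the form $f(z) = z g(z)$ where $g$ is a Stieltjes function. Let $A \in \mathbb{C}^{n\times n}$ be Hermitian positive definite with smallest eigenvalue $\lambda_{\min}$, and assume that $\lambda_{\min}$ is a simple eigenvalue of $A$. Then, with respect to the Frobenius norm, $$\mathrm{cond}_{\mathrm{abs}}^{[2]}(f, A) = |f''(\lambda_{\min})|.$$
   Context: A Stieltjes function is a function $g$ that can be represented as $g(z) = \int_0^\infty \frac{d\mu(t)}{t+z}$ (for $z\in\mathbb{C}\setminus(-\infty,0]$), where $d\mu$ is a nonnegative measure on $[0,\infty)$ (for which this integral converges). Condition numbers, taken here with respect to the Frobenius norm $\|\cdot\| = \|\cdot\|_F$ on $\mathbb{C}^{n\times n}$: the absolute condition number of $f$ at $A$ is $$\mathrm{cond}_{\mathrm{abs}}(f,A) = \lim_{\varepsilon\to 0}\ \sup_{\|E\|\le\varepsilon}\frac{\|f(A+E)-f(A)\|}{\varepsilon},$$ and the absolute level-2 condition number of $f$ at $A$ is $$\mathrm{cond}_{\mathrm{abs}}^{[2]}(f,A) = \lim_{\varepsilon\to 0}\ \sup_{\|Z\|\le\varepsilon}\frac{|\mathrm{cond}_{\mathrm{abs}}(f,A+Z)-\mathrm{cond}_{\mathrm{abs}}(f,A)|}{\varepsilon},$$ where $E, Z$ range over $\mathbb{C}^{n\times n}$. *)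

theory Defs
  imports "HOL-Analysis.Analysis" "HOL-Computational_Algebra.Polynomial"
begin

definition stieltjes :: "(complex \<Rightarrow> complex) \<Rightarrow> bool" where
  "stieltjes g \<longleftrightarrow> (\<exists>\<mu> :: real measure.
     sets \<mu> = sets (restrict_space borel {0..}) \<and>
     (\<forall>z. z \<notin> \<real>\<^sub>\<le>\<^sub>0 \<longrightarrow>
        integrable \<mu> (\<lambda>t. 1 / (complex_of_real t + z)) \<and>
        g z = (LINT t|\<mu>. 1 / (complex_of_real t + z))))"

definition hermitian :: "complex ^ 'n ^ 'n \<Rightarrow> bool" where
  "hermitian A \<longleftrightarrow> (\<forall>i j. A $ i $ j = cnj (A $ j $ i))"

(* For hermitian A the form x^* A x is real, so taking Re loses nothing. *)
definition hermitian_posdef :: "complex ^ 'n ^ 'n \<Rightarrow> bool" where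
  "hermitian_posdef A \<longleftrightarrow> hermitian A \<and>
     (\<forall>x. x \<noteq> 0 \<longrightarrow> 0 < Re (\<Sum>i\<in>UNIV. cnj (x $ i) * (A *v x) $ i))"

definition eigenvalue :: "complex ^ 'n ^ 'n \<Rightarrow> complex \<Rightarrow> bool" where
  "eigenvalue A l \<longleftrightarrow> (\<exists>v. v \<noteq> 0 \<and> A *v v = l *s v)"

(* Intended for hermitian matrices, all of whose eigenvalues are real. *)
definition smallest_eigenvalue :: "complex ^ 'n ^ 'n \<Rightarrow> real \<Rightarrow> bool" where
  "smallest_eigenvalue A l \<longleftrightarrow> eigenvalue A (complex_of_real l) \<and>
     (\<forall>m :: real. eigenvalue A (complex_of_real m) \<longrightarrow> l \<le> m)"

definition charpoly :: "complex ^ 'n ^ 'n \<Rightarrow> complex poly" where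
  "charpoly A = det (mat [:0, 1:] - (\<chi> i j. [:A $ i $ j:]))"

definition simple_eigenvalue :: "complex ^ 'n ^ 'n \<Rightarrow> complex \<Rightarrow> bool" where
  "simple_eigenvalue A l \<longleftrightarrow> order l (charpoly A) = 1"

(* The library's * and ^ act entrywise on vectors of vectors, hence a separate power. *)
primrec mat_pow :: "complex ^ 'n ^ 'n \<Rightarrow> nat \<Rightarrow> complex ^ 'n ^ 'n" where
  "mat_pow A 0 = mat 1"
| "mat_pow A (Suc k) = A ** mat_pow A k"

definition mat_poly :: "complex poly \<Rightarrow> complex ^ 'n ^ 'n \<Rightarrow> complex ^ 'n ^ 'n" where
  "mat_poly p A = (\<Sum>k\<le>degree p. mat (coeff p k) ** mat_pow A k)"

definition minpoly :: "complex ^ 'n ^ 'n \<Rightarrow> complex poly" where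
  "minpoly A = (ARG_MIN degree p. lead_coeff p = 1 \<and> mat_poly p A = 0)"

(* p is an Hermite interpolant of f on the spectrum of A: the order of l in the minimal
   polynomial is the size of the largest Jordan block of l, and 0 if l is no eigenvalue. *)
definition interpolates_on_spectrum ::
    "complex poly \<Rightarrow> (complex \<Rightarrow> complex) \<Rightarrow> complex ^ 'n ^ 'n \<Rightarrow> bool" where
  "interpolates_on_spectrum p f A \<longleftrightarrow>
     (\<forall>l. \<forall>j < order l (minpoly A). poly ((pderiv ^^ j) p) l = (deriv ^^ j) f l)"

(* The primary matrix function f(A). Two interpolants differ by a multiple of the minimal
   polynomial, so the value does not depend on the choice of p. *)
definition mat_fun ::
    "(complex \<Rightarrow> complex) \<Rightarrow> complex ^ 'n ^ 'n \<Rightarrow> complex ^ 'n ^ 'n" where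
  "mat_fun f A = mat_poly (SOME p. interpolates_on_spectrum p f A) A"

lemma norm_eq_frobenius:
  fixes M :: "complex ^ 'n ^ 'm"
  shows "norm M = sqrt (\<Sum>i\<in>UNIV. \<Sum>j\<in>UNIV. (cmod (M $ i $ j))\<^sup>2)"
  by (simp add: norm_vec_def L2_set_def sum_nonneg)

(* Suprema are taken in ereal, where they are total: on real, an unbounded set has no
   meaningful SUP. The norm is the Frobenius norm by norm_eq_frobenius. *)
definition cond_abs_quot ::
    "(complex \<Rightarrow> complex) \<Rightarrow> complex ^ 'n ^ 'n \<Rightarrow> real \<Rightarrow> ereal" where
  "cond_abs_quot f A \<epsilon> =
     (SUP E \<in> {E. norm E \<le> \<epsilon>}. ereal (norm (mat_fun f (A + E) - mat_fun f A) / \<epsilon>))"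

definition cond_abs :: "(complex \<Rightarrow> complex) \<Rightarrow> complex ^ 'n ^ 'n \<Rightarrow> ereal" where
  "cond_abs f A = Lim (at_right 0) (cond_abs_quot f A)"

definition cond_abs2_quot ::
    "(complex \<Rightarrow> complex) \<Rightarrow> complex ^ 'n ^ 'n \<Rightarrow> real \<Rightarrow> ereal" where
  "cond_abs2_quot f A \<epsilon> =
     (SUP Z \<in> {Z. norm Z \<le> \<epsilon>}. \<bar>cond_abs f (A + Z) - cond_abs f A\<bar> / ereal \<epsilon>)"

definition cond_abs2 :: "(complex \<Rightarrow> complex) \<Rightarrow> complex ^ 'n ^ 'n \<Rightarrow> ereal" where
  "cond_abs2 f A = Lim (at_right 0) (cond_abs2_quot f A)"

(* Lim is unspecified where there is no limit; this says that the limits defining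
   cond_abs2 f A (those in cond_abs at A and all nearby matrices, and the outer one) exist. *)
definition cond_abs2_exists :: "(complex \<Rightarrow> complex) \<Rightarrow> complex ^ 'n ^ 'n \<Rightarrow> bool" where
  "cond_abs2_exists f A \<longleftrightarrow>
     (\<forall>\<^sub>F Z in nhds 0. \<exists>c. (cond_abs_quot f (A + Z) \<longlongrightarrow> c) (at_right 0)) \<and>
     (\<exists>c. (cond_abs2_quot f A \<longlongrightarrow> c) (at_right 0))"

end

theory Submission
  imports Defs "HOL-Computational_Algebra.Fundamental_Theorem_Algebra"
    "HOL-Complex_Analysis.Cauchy_Integral_Formula"
begin

text \<open>
  Let \<open>R\<^sub>t(X) = (t + X)\<^sup>-\<^sup>1\<close>. For \<open>f(z) = \<integral> 1 / (t + z) d\<mu>(t)\<close> the matrix function is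
  \<open>f(X) = \<integral> R\<^sub>t(X) d\<mu>(t)\<close>; if \<open>f\<close> is \<open>z\<close> times such a function, the identity
  \<open>X R\<^sub>t(X) = 1 - t R\<^sub>t(X)\<close> turns \<open>f(Y) - f(X)\<close> into \<open>- \<integral> t (R\<^sub>t(Y) - R\<^sub>t(X)) d\<mu>(t)\<close>. So in both
  cases, with \<open>w = 1\<close> or \<open>w = t\<close> and a sign \<open>s\<close>,
  \<open>f(Y) - f(X) = s \<integral> w(t) (R\<^sub>t(Y) - R\<^sub>t(X)) d\<mu>(t)\<close>.
  By the resolvent identity the Frechet derivative of \<open>f\<close> at \<open>X\<close> is, up to sign,
  \<open>E \<mapsto> \<integral> w(t) R\<^sub>t(X) E R\<^sub>t(X) d\<mu>(t)\<close>, and the condition number is its operator norm.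

  Everything then follows from the bound \<open>1 / (t + c)\<close> on \<open>R\<^sub>t(X)\<close>, where \<open>c > 0\<close> is a lower bound for
  the quadratic form \<open>Re x\<^sup>* X x\<close> on the unit sphere. This bound holds for non-hermitian \<open>X\<close> as
  well, and it survives a perturbation \<open>Z\<close> with \<open>\<parallel>Z\<parallel> < c\<close>, with \<open>c\<close> replaced by \<open>c - \<parallel>Z\<parallel>\<close>. Write \<open>l\<close> for the smallest eigenvalue
  of \<open>A\<close> and \<open>m\<^sub>k(c) = \<integral> w(t) / (t + c)\<^sup>k d\<mu>(t)\<close>.

  \<^item> Upper bound: expanding the difference of the two derivatives gives
    \<open>\<bar>cond(A + Z) - cond(A)\<bar> \<le> 2 \<epsilon> m\<^sub>3(l - \<epsilon>)\<close> whenever \<open>\<parallel>Z\<parallel> \<le> \<epsilon>\<close>.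
  \<^item> Lower bound: let \<open>W = v v\<^sup>*\<close> for a unit eigenvector \<open>v\<close> of \<open>l\<close>, and \<open>Z = - \<epsilon> W\<close>. Since
    \<open>R\<^sub>t(A + Z) W R\<^sub>t(A + Z) = (t + l - \<epsilon>)\<^sup>-\<^sup>2 W\<close>, we get \<open>cond(A + Z) \<ge> m\<^sub>2(l - \<epsilon>)\<close>, while
    \<open>cond(A) \<le> m\<^sub>2(l)\<close>; by convexity \<open>m\<^sub>2(l - \<epsilon>) - m\<^sub>2(l) \<ge> 2 \<epsilon> m\<^sub>3(l)\<close>.

  As \<open>\<epsilon> \<rightarrow> 0\<close> both bounds give \<open>2 m\<^sub>3(l)\<close> (\<open>cond_abs2_eq_moment\<close>), and differentiating the scalar
  representation twice gives \<open>\<bar>f''(l)\<bar> = 2 m\<^sub>3(l)\<close> (\<open>cmod_deriv2_eq_moment\<close>).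

  The integral formula for \<open>f(X)\<close> has to be derived from the definition by Hermite interpolation.
  For fixed \<open>t\<close>, polynomial division gives an interpolant \<open>p\<^sub>t\<close> of \<open>1 / (t + z)\<close> with
  \<open>p\<^sub>t(X) = R\<^sub>t(X)\<close>; the coefficientwise integral of \<open>p\<^sub>t\<close> interpolates \<open>f\<close> (\<open>stieltjes_interpolant\<close>).
\<close>

section \<open>Accretive matrices and their resolvents\<close>

text \<open>The Frobenius norm is compatible with the spectral norm on either side: a left factor acts on
  each column separately, a right factor on each row.\<close>
lemma norm_matrix_mult_left_le:
  fixes M :: "complex ^ 'n ^ 'm" and N :: "complex ^ 'k ^ 'n"
  assumes "\<And>x. norm (M *v x) \<le> b * norm x"
  shows "norm (M ** N) \<le> b * norm N"
proof -
  have b: "0 \<le> b"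
    using order_trans[OF norm_ge_zero assms[of "axis undefined 1"]] by simp
  have col: "(\<Sum>i\<in>UNIV. (cmod ((M ** N) $ i $ j))\<^sup>2) \<le> b\<^sup>2 * (\<Sum>i\<in>UNIV. (cmod (N $ i $ j))\<^sup>2)" for j
  proof -
    have "(\<Sum>i\<in>UNIV. (cmod ((M ** N) $ i $ j))\<^sup>2) = (norm (M *v column j N))\<^sup>2"
      by (simp add: norm_vec_def L2_set_def sum_nonneg matrix_matrix_mult_def
          matrix_vector_mult_def column_def)
    also have "\<dots> \<le> (b * norm (column j N))\<^sup>2"
      by (intro power_mono assms) simp
    also have "\<dots> = b\<^sup>2 * (\<Sum>i\<in>UNIV. (cmod (N $ i $ j))\<^sup>2)"
      by (simp add: norm_vec_def L2_set_def sum_nonneg column_def power_mult_distrib)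
    finally show ?thesis .
  qed
  have "(\<Sum>i\<in>UNIV. \<Sum>j\<in>UNIV. (cmod ((M ** N) $ i $ j))\<^sup>2)
      \<le> b\<^sup>2 * (\<Sum>i\<in>UNIV. \<Sum>j\<in>UNIV. (cmod (N $ i $ j))\<^sup>2)"
  proof -
    have "(\<Sum>j\<in>UNIV. \<Sum>i\<in>UNIV. (cmod ((M ** N) $ i $ j))\<^sup>2)
        \<le> (\<Sum>j\<in>UNIV. b\<^sup>2 * (\<Sum>i\<in>UNIV. (cmod (N $ i $ j))\<^sup>2))"
      by (intro sum_mono col)
    then show ?thesis
      by (subst (1 2) sum.swap) (simp only: sum_distrib_left)
  qed
  then have "norm (M ** N) \<le> sqrt (b\<^sup>2 * (\<Sum>i\<in>UNIV. \<Sum>j\<in>UNIV. (cmod (N $ i $ j))\<^sup>2))"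
    unfolding norm_eq_frobenius by simp
  then show ?thesis
    using b by (simp add: norm_eq_frobenius real_sqrt_mult)
qed

lemma norm_transpose: "norm (transpose M) = norm (M :: complex ^ 'n ^ 'm)"
  by (subst (1 2) norm_eq_frobenius, subst sum.swap) (simp add: transpose_def)

lemma norm_matrix_mult_right_le:
  fixes M :: "complex ^ 'n ^ 'm" and N :: "complex ^ 'm ^ 'k"
  assumes "\<And>x. norm (x v* M) \<le> b * norm x"
  shows "norm (N ** M) \<le> b * norm N"
proof -
  have "norm (transpose M ** transpose N) \<le> b * norm (transpose N)"
    by (rule norm_matrix_mult_left_le) (use assms in simp)
  then show ?thesis
    by (simp add: norm_transpose flip: matrix_transpose_mul)
qed

lemma norm_matrix_vector_mult_le: "norm (M *v x) \<le> norm M * norm (x :: complex ^ 'n)"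
  for M :: "complex ^ 'n ^ 'm"
proof -
  have "cmod ((M *v x) $ i) \<le> norm (M $ i) * norm x" for i
  proof -
    have "cmod ((M *v x) $ i) \<le> (\<Sum>j\<in>UNIV. \<bar>cmod (M $ i $ j)\<bar> * \<bar>cmod (x $ j)\<bar>)"
      unfolding matrix_vector_mult_def by (auto intro!: sum_norm_le simp: norm_mult)
    also have "\<dots> \<le> norm (M $ i) * norm x"
      unfolding norm_vec_def by (rule L2_set_mult_ineq)
    finally show ?thesis .
  qed
  then have "norm (M *v x) \<le> L2_set (\<lambda>i. norm (M $ i) * norm x) UNIV"
    unfolding norm_vec_def[of "M *v x"] by (intro L2_set_mono) auto
  also have "\<dots> = norm M * norm x"
    by (simp add: L2_set_left_distrib norm_vec_def[of M])
  finally show ?thesis .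
qed

lemma norm_matrix_mult_le: "norm (M ** N) \<le> norm M * norm N"
  for M :: "complex ^ 'n ^ 'm" and N :: "complex ^ 'k ^ 'n"
  by (intro norm_matrix_mult_left_le norm_matrix_vector_mult_le)

interpretation matrix_mult: bounded_bilinear
  "(**) :: complex ^ 'n ^ 'm \<Rightarrow> complex ^ 'k ^ 'n \<Rightarrow> complex ^ 'k ^ 'm"
  by (rule bounded_bilinear.intro)
     (auto simp: vec_eq_iff matrix_matrix_mult_def sum.distrib distrib_left distrib_right
       scaleR_sum_right intro!: exI[of _ 1] norm_matrix_mult_le[unfolded matrix_matrix_mult_def])

lemma mat_mult_entry: "(mat c ** M) $ i $ j = c * M $ i $ j"
  for M :: "complex ^ 'k ^ 'n"
  by (simp add: matrix_matrix_mult_def mat_def if_distrib[of "\<lambda>u. u * _"] cong: if_cong)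

lemma mult_mat_entry: "(M ** mat c) $ i $ j = c * M $ i $ j"
  for M :: "complex ^ 'n ^ 'k"
  by (simp add: matrix_matrix_mult_def mat_def if_distrib cong: if_cong)

lemma mat_mult_commute: "mat c ** M = M ** mat c" for M :: "complex ^ 'n ^ 'n"
  by (simp add: vec_eq_iff mat_mult_entry mult_mat_entry)

lemma norm_mat_mult: "norm (mat c ** M) = cmod c * norm M" for M :: "complex ^ 'k ^ 'n"
proof -
  have "(\<Sum>i\<in>UNIV. \<Sum>j\<in>UNIV. (cmod ((mat c ** M) $ i $ j))\<^sup>2)
      = (cmod c)\<^sup>2 * (\<Sum>i\<in>UNIV. \<Sum>j\<in>UNIV. (cmod (M $ i $ j))\<^sup>2)"
    by (simp add: mat_mult_entry norm_mult power_mult_distrib sum_distrib_left)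
  then show ?thesis by (simp add: norm_eq_frobenius real_sqrt_mult)
qed

lemma mat_of_real_mult: "mat (complex_of_real c) ** M = c *\<^sub>R M" for M :: "complex ^ 'k ^ 'n"
  by (simp add: vec_eq_iff mat_mult_entry scaleR_conv_of_real[where 'a=complex])

lemma mat_mult_vector: "mat c *v x = c *s x" for x :: "complex ^ 'n"
  by (simp add: vec_eq_iff matrix_vector_mult_def mat_def if_distribR if_distrib[of "\<lambda>u. u * _"] sum.delta cong: if_cong)

lemma of_real_vector_smult: "complex_of_real c *s x = c *\<^sub>R x" for x :: "complex ^ 'n"
  by (simp add: vec_eq_iff scaleR_conv_of_real[where 'a=complex])

text \<open>The real inner product of complex vectors is \<open>Re (x\<^sup>* y)\<close>, so this bounds the real part of the
  numerical range from below. Unlike positive definiteness it makes sense for the non-hermitian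
  perturbations of a hermitian matrix.\<close>
definition accretive :: "real \<Rightarrow> complex ^ 'n ^ 'n \<Rightarrow> bool" where
  "accretive c X \<longleftrightarrow> (\<forall>x. c * (norm x)\<^sup>2 \<le> x \<bullet> (X *v x))"

lemma inner_eq_Re_form: "x \<bullet> y = Re (\<Sum>i\<in>UNIV. cnj (x $ i) * y $ i)" for x y :: "complex ^ 'n"
  by (simp add: inner_vec_def inner_complex_def)

text \<open>The form of the transpose at \<open>x\<close> is that of \<open>X\<close> at the conjugate of \<open>x\<close>. This transfers bounds
  for a resolvent acting on columns to its action on rows.\<close>
lemma accretive_transpose:
  fixes X :: "complex ^ 'n ^ 'n"
  assumes "accretive c X"
  shows "accretive c (transpose X)"
  unfolding accretive_def
proof
  fix x :: "complex ^ 'n"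
  define y where "y = (\<chi> i. cnj (x $ i))"
  have "c * (norm y)\<^sup>2 \<le> y \<bullet> (X *v y)"
    using assms by (simp add: accretive_def)
  also have "y \<bullet> (X *v y) = Re (\<Sum>i\<in>UNIV. \<Sum>j\<in>UNIV. x $ i * (X $ i $ j * cnj (x $ j)))"
    by (simp add: inner_eq_Re_form y_def matrix_vector_mult_def sum_distrib_left)
  also have "\<dots> = Re (\<Sum>j\<in>UNIV. \<Sum>i\<in>UNIV. x $ i * (X $ i $ j * cnj (x $ j)))"
    by (subst sum.swap) simp
  also have "\<dots> = x \<bullet> (transpose X *v x)"
    by (simp add: inner_eq_Re_form matrix_vector_mult_def transpose_def sum_distrib_left ac_simps
             del: transpose_matrix_vector)
  finally show "c * (norm x)\<^sup>2 \<le> x \<bullet> (transpose X *v x)"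
    by (simp add: y_def norm_vec_def del: transpose_matrix_vector)
qed

lemma accretive_mono: "accretive c X \<Longrightarrow> d \<le> c \<Longrightarrow> accretive d X"
  unfolding accretive_def by (meson mult_right_mono order_trans zero_le_power2)

lemma accretive_perturb:
  fixes X :: "complex ^ 'n ^ 'n"
  assumes "accretive c X"
  shows "accretive (c - norm Z) (X + Z)"
  unfolding accretive_def
proof
  fix x :: "complex ^ 'n"
  have "\<bar>x \<bullet> (Z *v x)\<bar> \<le> norm x * norm (Z *v x)"
    by (rule Cauchy_Schwarz_ineq2)
  also have "\<dots> \<le> norm x * (norm Z * norm x)"
    by (intro mult_left_mono norm_matrix_vector_mult_le) simp
  finally have "- (norm Z * (norm x)\<^sup>2) \<le> x \<bullet> (Z *v x)"
    by (simp add: power2_eq_square ac_simps abs_le_iff)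
  moreover have "c * (norm x)\<^sup>2 \<le> x \<bullet> (X *v x)"
    using assms by (simp add: accretive_def)
  ultimately show "(c - norm Z) * (norm x)\<^sup>2 \<le> x \<bullet> ((X + Z) *v x)"
    by (simp add: matrix_vector_mult_add_rdistrib inner_add_right algebra_simps)
qed

lemma accretive_shift:
  fixes X :: "complex ^ 'n ^ 'n"
  assumes "accretive c X"
  shows "accretive (t + c) (mat (of_real t) + X)"
  using assms
  by (auto simp: accretive_def matrix_vector_mult_add_rdistrib inner_add_right mat_mult_vector
      of_real_vector_smult power2_norm_eq_inner algebra_simps)

lemma accretive_norm_ge:
  fixes X :: "complex ^ 'n ^ 'n"
  assumes "accretive c X"
  shows "c * norm x \<le> norm (X *v x)"
proof (cases "x = 0")
  case False
  have "c * (norm x)\<^sup>2 \<le> norm x * norm (X *v x)"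
    using assms norm_cauchy_schwarz[of x "X *v x"] unfolding accretive_def by (meson order_trans)
  then have "norm x * (c * norm x) \<le> norm x * norm (X *v x)"
    by (simp add: power2_eq_square ac_simps)
  then show ?thesis using False by simp
qed simp

lemma accretive_eigenvalue:
  fixes X :: "complex ^ 'n ^ 'n"
  assumes "accretive c X" "X *v v = l *s v" "v \<noteq> 0"
  shows "c \<le> Re l"
proof -
  have "c * (norm v)\<^sup>2 \<le> v \<bullet> (l *s v)"
    using assms by (metis accretive_def)
  also have "v \<bullet> (l *s v) = Re l * (norm v)\<^sup>2"
  proof -
    have "(v $ i) \<bullet> (l * v $ i) = Re l * (v $ i \<bullet> v $ i)" for i
      by (simp add: inner_complex_def algebra_simps)
    then show ?thesis
      by (simp add: power2_norm_eq_inner inner_vec_def sum_distrib_left)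
  qed
  finally show ?thesis using assms(3) by simp
qed

lemma accretive_invertible:
  fixes X :: "complex ^ 'n ^ 'n"
  assumes "accretive c X" "0 < c"
  shows "invertible X"
  unfolding invertible_left_inverse matrix_left_invertible_ker
proof (intro allI impI)
  fix x assume "X *v x = 0"
  with accretive_norm_ge[OF assms(1), of x] have "c * norm x \<le> 0" by simp
  then show "x = 0" using assms(2) by (simp add: mult_le_0_iff)
qed

text \<open>The argument is the negative of the usual spectral parameter, which suits integration over
  \<open>t \<ge> 0\<close>.\<close>
definition resolvent :: "complex ^ 'n ^ 'n \<Rightarrow> real \<Rightarrow> complex ^ 'n ^ 'n" where
  "resolvent X t = matrix_inv (mat (of_real t) + X)"

lemma resolvent_mult:
  fixes X :: "complex ^ 'n ^ 'n"
  assumes "accretive c X" "0 < t + c"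
  shows "resolvent X t ** (mat (of_real t) + X) = mat 1"
    and "(mat (of_real t) + X) ** resolvent X t = mat 1"
proof -
  let ?M = "mat (of_real t) + X"
  have "invertible ?M"
    using accretive_invertible[OF accretive_shift[OF assms(1)] assms(2)] .
  then have "?M ** matrix_inv ?M = mat 1 \<and> matrix_inv ?M ** ?M = mat 1"
    unfolding matrix_inv_def invertible_def by (rule someI_ex)
  then show "resolvent X t ** ?M = mat 1" "?M ** resolvent X t = mat 1"
    by (simp_all add: resolvent_def)
qed

lemma norm_resolvent_vector_le:
  fixes X :: "complex ^ 'n ^ 'n"
  assumes "accretive c X" "0 < t + c"
  shows "norm (resolvent X t *v x) \<le> 1 / (t + c) * norm x"
    and "norm (x v* resolvent X t) \<le> 1 / (t + c) * norm x"
proof -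
  let ?M = "mat (of_real t) + X"
  have acc: "accretive (t + c) ?M" by (rule accretive_shift[OF assms(1)])
  have "(t + c) * norm (resolvent X t *v x) \<le> norm (?M *v (resolvent X t *v x))"
    by (rule accretive_norm_ge[OF acc])
  then show "norm (resolvent X t *v x) \<le> 1 / (t + c) * norm x"
    using assms by (simp add: matrix_vector_mul_assoc resolvent_mult[OF assms] pos_le_divide_eq mult.commute)
  have "(t + c) * norm (x v* resolvent X t) \<le> norm (transpose ?M *v (x v* resolvent X t))"
    by (rule accretive_norm_ge[OF accretive_transpose[OF acc]])
  then show "norm (x v* resolvent X t) \<le> 1 / (t + c) * norm x"
    using assms by (simp add: vector_matrix_mul_assoc resolvent_mult[OF assms] pos_le_divide_eq mult.commute)
qed

lemma norm_resolvent_mult_le: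
  fixes X E :: "complex ^ 'n ^ 'n"
  assumes "accretive c X" "0 < t + c"
  shows "norm (resolvent X t ** E) \<le> norm E / (t + c)"
    and "norm (E ** resolvent X t) \<le> norm E / (t + c)"
  using norm_matrix_mult_left_le[OF norm_resolvent_vector_le(1)[OF assms], of E]
    norm_matrix_mult_right_le[OF norm_resolvent_vector_le(2)[OF assms], of E]
  by simp_all

lemma resolvent_diff:
  fixes X Y :: "complex ^ 'n ^ 'n"
  assumes "accretive c X" "0 < t + c" "accretive d Y" "0 < t + d"
  shows "resolvent Y t - resolvent X t = resolvent Y t ** (X - Y) ** resolvent X t"
proof -
  have "resolvent Y t ** (X - Y) ** resolvent X t
      = resolvent Y t ** ((mat (of_real t) + X) - (mat (of_real t) + Y)) ** resolvent X t"
    by simp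
  also have "\<dots> = resolvent Y t ** ((mat (of_real t) + X) ** resolvent X t)
      - (resolvent Y t ** (mat (of_real t) + Y)) ** resolvent X t"
    by (simp only: matrix_mult.diff_left matrix_mult.diff_right matrix_mul_assoc)
  also have "\<dots> = resolvent Y t - resolvent X t"
    by (simp add: resolvent_mult[OF assms(1,2)] resolvent_mult[OF assms(3,4)])
  finally show ?thesis by simp
qed

lemma resolvent_eqI:
  fixes X :: "complex ^ 'n ^ 'n"
  assumes "accretive c X" "0 < t + c" "(mat (of_real t) + X) ** B = mat 1"
  shows "resolvent X t = B"
proof -
  have "resolvent X t = resolvent X t ** ((mat (of_real t) + X) ** B)"
    using assms(3) by simp
  also have "\<dots> = B"
    by (simp add: matrix_mul_assoc resolvent_mult[OF assms(1,2)])
  finally show ?thesis .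
qed

section \<open>Minimal polynomial and Hermite interpolation\<close>

lemma mat_poly_eq_sum:
  assumes "degree p \<le> N"
  shows "mat_poly p A = (\<Sum>k\<le>N. mat (coeff p k) ** mat_pow A k)"
proof -
  have "mat (coeff p k) ** mat_pow A k = 0" if "k \<notin> {..degree p}" for k
    using that by (simp add: coeff_eq_0 vec_eq_iff mat_mult_entry)
  then show ?thesis
    unfolding mat_poly_def using assms by (intro sum.mono_neutral_left) auto
qed

lemma mat_poly_0 [simp]: "mat_poly 0 A = 0"
  by (simp add: mat_poly_def vec_eq_iff mat_mult_entry)

lemma mat_poly_1 [simp]: "mat_poly 1 A = mat 1"
  by (simp add: mat_poly_def)

lemma mat_add: "mat (a + b) = mat a + (mat b :: complex ^ 'n ^ 'n)"
  by (simp add: vec_eq_iff mat_def)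

lemma mat_poly_add: "mat_poly (p + q) A = mat_poly p A + mat_poly q A"
proof -
  let ?N = "max (degree p) (degree q)"
  have "degree (p + q) \<le> ?N" by (rule degree_add_le_max)
  then show ?thesis
    by (simp add: mat_poly_eq_sum[of _ ?N] mat_add matrix_mult.add_left sum.distrib)
qed

lemma mat_poly_smult: "mat_poly (smult c p) (A :: complex ^ 'a ^ 'a) = mat c ** mat_poly p A"
proof -
  have "mat (c * a) ** M = mat c ** (mat a ** M)" for a and M :: "complex ^ 'a ^ 'a"
    by (simp add: vec_eq_iff mat_mult_entry)
  then show ?thesis
    by (simp add: mat_poly_eq_sum[OF degree_smult_le] matrix_mult.sum_right)
       (simp add: mat_poly_def matrix_mult.sum_right)
qed

lemma mat_poly_minus: "mat_poly (- p) A = - mat_poly p A"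
  using mat_poly_smult[of "- 1" p A] by (simp add: vec_eq_iff mat_mult_entry)

lemma mat_poly_diff: "mat_poly (p - q) A = mat_poly p A - mat_poly q A"
  using mat_poly_add[of p "- q" A] by (simp add: mat_poly_minus)

lemma mat_poly_pCons: "mat_poly (pCons a p) A = mat a + A ** mat_poly p A"
proof -
  have "degree (pCons a p) \<le> Suc (degree p)" by (rule degree_pCons_le)
  then have "mat_poly (pCons a p) A =
      (\<Sum>k\<le>Suc (degree p). mat (coeff (pCons a p) k) ** mat_pow A k)"
    by (rule mat_poly_eq_sum)
  also have "\<dots> = mat a + (\<Sum>k\<le>degree p. mat (coeff p k) ** (A ** mat_pow A k))"
    by (subst sum.atMost_Suc_shift) simp
  also have "(\<Sum>k\<le>degree p. mat (coeff p k) ** (A ** mat_pow A k)) = A ** mat_poly p A"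
    by (simp add: mat_poly_def matrix_mult.sum_right matrix_mul_assoc mat_mult_commute[of _ A])
  finally show ?thesis .
qed

lemma mat_poly_const: "mat_poly [:a:] A = mat a"
  by (simp add: mat_poly_pCons matrix_mult.zero_right)

lemma mat_poly_linear: "mat_poly [:a, 1:] A = mat a + A"
  by (simp add: mat_poly_pCons flip: one_pCons)

lemma mat_poly_mult: "mat_poly (p * q) A = mat_poly p A ** mat_poly q A"
  by (induction p)
     (simp_all add: mat_poly_add mat_poly_smult mat_poly_pCons matrix_mult.add_left
       matrix_mul_assoc)

text \<open>The matrices form a finite-dimensional real vector space, so the powers of \<open>A\<close> are either not
  pairwise distinct or, being distinct and infinitely many, linearly dependent.\<close>
lemma exists_annihilating_poly:
  fixes A :: "complex ^ 'n ^ 'n"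
  shows "\<exists>p. lead_coeff p = 1 \<and> mat_poly p A = 0"
proof -
  have "\<exists>p. p \<noteq> 0 \<and> mat_poly p A = 0"
  proof (cases "inj (mat_pow A)")
    case False
    then obtain i j where ij: "i < j" "mat_pow A i = mat_pow A j"
      unfolding inj_on_def by (metis linorder_neqE_nat)
    have pw: "mat_poly (monom 1 k) A = mat_pow A k" for k
    proof -
      have "mat_poly (monom 1 k) A = (\<Sum>l\<le>k. if l = k then mat_pow A l else 0)"
        by (subst mat_poly_eq_sum[of _ k], simp add: degree_monom_eq)
           (intro sum.cong refl, simp add: vec_eq_iff mat_mult_entry)
      then show ?thesis by simp
    qed
    have "coeff (monom 1 j - monom 1 i :: complex poly) j = 1"
      using ij by simp
    then have "monom 1 j - monom 1 i \<noteq> (0 :: complex poly)"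
      by (metis coeff_0 zero_neq_one)
    moreover have "mat_poly (monom 1 j - monom 1 i) A = 0"
      by (simp add: mat_poly_diff pw ij)
    ultimately show ?thesis by blast
  next
    case True
    define N where "N = DIM(complex ^ 'n ^ 'n)"
    let ?S = "mat_pow A ` {..N}"
    have "card ?S = Suc N"
      using True by (subst card_image) (auto intro: inj_on_subset)
    then have "dependent ?S"
      by (intro dependent_biggerset) (auto simp: N_def)
    then obtain u v where u: "(\<Sum>M\<in>?S. u M *\<^sub>R M) = 0" and v: "v \<in> ?S" "u v \<noteq> 0"
      by (subst (asm) dependent_finite) auto
    define p where "p = (\<Sum>k\<le>N. monom (complex_of_real (u (mat_pow A k))) k)"
    have co: "coeff p k = (if k \<le> N then of_real (u (mat_pow A k)) else 0)" for k
      by (simp add: p_def coeff_sum sum.delta)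
    have "degree p \<le> N"
      by (rule degree_le) (simp add: co)
    then have "mat_poly p A = (\<Sum>k\<le>N. u (mat_pow A k) *\<^sub>R mat_pow A k)"
      by (simp add: mat_poly_eq_sum co mat_of_real_mult)
    also have "\<dots> = (\<Sum>M\<in>?S. u M *\<^sub>R M)"
      using True by (subst sum.reindex) (auto intro: inj_on_subset)
    finally have "mat_poly p A = 0" by (simp add: u)
    moreover have "p \<noteq> 0"
      using v co by (metis (no_types, lifting) atMost_iff coeff_0 image_iff of_real_eq_0_iff)
    ultimately show ?thesis by blast
  qed
  then obtain p where p: "p \<noteq> 0" "mat_poly p A = 0" by blast
  then have "lead_coeff (smult (1 / lead_coeff p) p) = 1"
    by (simp only: lead_coeff_smult) simp
  moreover have "mat_poly (smult (1 / lead_coeff p) p) A = 0"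
    by (simp add: mat_poly_smult p matrix_mult.zero_right)
  ultimately show ?thesis by blast
qed

lemma minpoly_monic: "lead_coeff (minpoly A) = 1"
  and mat_poly_minpoly: "mat_poly (minpoly A) A = 0"
  and degree_minpoly_le: "lead_coeff p = 1 \<Longrightarrow> mat_poly p A = 0 \<Longrightarrow> degree (minpoly A) \<le> degree p"
proof -
  obtain q where q: "lead_coeff q = 1 \<and> mat_poly q A = 0"
    using exists_annihilating_poly by blast
  show "lead_coeff (minpoly A) = 1" "mat_poly (minpoly A) A = 0"
    using arg_min_natI[of "\<lambda>p. lead_coeff p = 1 \<and> mat_poly p A = 0" q degree, OF q]
    unfolding minpoly_def by auto
  show "degree (minpoly A) \<le> degree p" if "lead_coeff p = 1" "mat_poly p A = 0"
    using arg_min_nat_le[of "\<lambda>p. lead_coeff p = 1 \<and> mat_poly p A = 0" p degree] that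
    unfolding minpoly_def by auto
qed

lemma minpoly_nonzero: "minpoly A \<noteq> 0"
  using minpoly_monic[of A] by auto

text \<open>If \<open>minpoly A = (z - l) q\<close>, then \<open>q(A) \<noteq> 0\<close> by minimality, and any nonzero column of \<open>q(A)\<close>
  is an eigenvector.\<close>
lemma minpoly_root_eigenvalue:
  assumes "poly (minpoly A) l = 0"
  shows "\<exists>v. v \<noteq> 0 \<and> A *v v = l *s v"
proof -
  obtain q where q: "minpoly A = [:-l, 1:] * q"
    using assms by (auto simp: poly_eq_0_iff_dvd)
  have q0: "q \<noteq> 0" using q minpoly_nonzero[of A] by auto
  have "lead_coeff q = 1"
    using minpoly_monic[of A] by (simp only: q lead_coeff_mult) simp
  moreover have "degree (minpoly A) = Suc (degree q)"
    using degree_mult_eq[of "[:-l, 1:]" q] q0 by (simp only: q) simp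
  ultimately have "mat_poly q A \<noteq> 0"
    using degree_minpoly_le[of q A] by auto
  then obtain j where j: "column j (mat_poly q A) \<noteq> 0"
    by (auto simp: vec_eq_iff column_def)
  have "(mat (- l) + A) ** mat_poly q A = 0"
    using mat_poly_minpoly[of A] by (simp only: q mat_poly_mult mat_poly_linear)
  then have "(mat (- l) + A) *v column j (mat_poly q A) = 0"
    by (simp add: vec_eq_iff matrix_matrix_mult_def matrix_vector_mult_def column_def)
  then have "A *v column j (mat_poly q A) = l *s column j (mat_poly q A)"
    by (simp add: matrix_vector_mult_add_rdistrib mat_mult_vector vec_eq_iff
        eq_neg_iff_add_eq_0 add.commute)
  then show ?thesis using j by blast
qed

lemma accretive_minpoly_root:
  assumes "accretive c A" "poly (minpoly A) l = 0"
  shows "c \<le> Re l"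
  using minpoly_root_eigenvalue[OF assms(2)] accretive_eigenvalue[OF assms(1)] by blast

lemma higher_pderiv_root:
  fixes p :: "complex poly"
  assumes "j < order l p"
  shows "poly ((pderiv ^^ j) p) l = 0"
proof -
  have "[:-l, 1:] ^ (k - j) dvd (pderiv ^^ j) p" if "[:-l, 1:] ^ k dvd p" for k
    using that
  proof (induction j)
    case (Suc j)
    then have "[:-l, 1:] ^ (k - j) dvd (pderiv ^^ j) p" by blast
    then obtain q where q: "(pderiv ^^ j) p = [:-l, 1:] ^ (k - j) * q" by (rule dvdE)
    show ?case
    proof (cases "k - j")
      case (Suc i)
      have "pderiv ([:-l, 1:] ^ Suc i * q)
          = [:-l, 1:] ^ i * ([:-l, 1:] * pderiv q + smult (of_nat (Suc i)) q)"
        by (simp add: pderiv_mult pderiv_power_Suc pderiv_pCons algebra_simps del: power_Suc)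
           (simp add: algebra_simps)
      moreover have "k - Suc j = i" using Suc by simp
      ultimately show ?thesis using q Suc by (simp del: power_Suc mult_pCons_left)
    qed simp
  qed auto
  then have "[:-l, 1:] ^ (order l p - j) dvd (pderiv ^^ j) p"
    using order_1 by blast
  moreover have "[:-l, 1:] dvd [:-l, 1:] ^ (order l p - j)"
    by (rule dvd_power) (use assms in auto)
  ultimately have "[:-l, 1:] dvd (pderiv ^^ j) p"
    by (metis dvd_trans)
  then show ?thesis by (simp add: poly_eq_0_iff_dvd)
qed

lemma power_dvd_if_higher_pderivs_vanish:
  fixes p :: "complex poly"
  assumes "\<And>j. j < k \<Longrightarrow> poly ((pderiv ^^ j) p) l = 0"
  shows "[:-l, 1:] ^ k dvd p"
  using assms
proof (induction k arbitrary: p)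
  case (Suc k)
  have root: "poly p l = 0" using Suc.prems[of 0] by simp
  show ?case
  proof (cases "p = 0")
    case False
    have "pderiv p \<noteq> 0"
    proof
      assume "pderiv p = 0"
      then obtain a where "p = [:a:]" by (metis pderiv_iszero)
      with root False show False by simp
    qed
    moreover have "[:-l, 1:] ^ k dvd pderiv p"
    proof (rule Suc.IH)
      show "poly ((pderiv ^^ j) (pderiv p)) l = 0" if "j < k" for j
        using Suc.prems[of "Suc j"] that by (simp add: funpow_swap1)
    qed
    moreover have "order l p = Suc (order l (pderiv p))"
      using order_pderiv[of p l] \<open>pderiv p \<noteq> 0\<close> False root by (simp add: order_root)
    ultimately show ?thesis
      by (metis Suc_le_mono order_divides)
  qed simp
qed simp

text \<open>The powers of linear factors are collected one root at a time: the product over the roots other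
  than \<open>l\<close> does not vanish at \<open>l\<close>, so it does not affect the order there.\<close>
lemma dvd_if_order_le:
  fixes m p :: "complex poly"
  assumes "m \<noteq> 0" "\<And>l. [:-l, 1:] ^ order l m dvd p"
  shows "m dvd p"
proof -
  have fin: "finite {z. poly m z = 0}" using assms(1) by (rule poly_roots_finite)
  have "(\<Prod>z\<in>S. [:-z, 1:] ^ order z m) dvd p" if "finite S" for S
    using that
  proof (induction S)
    case (insert l S)
    let ?P = "\<Prod>z\<in>S. [:-z, 1:] ^ order z m"
    from insert.IH obtain r where p: "p = ?P * r" by (rule dvdE)
    have "poly ?P l \<noteq> 0"
      using insert.hyps by (auto simp: poly_prod)
    then have P: "?P \<noteq> 0" "order l ?P = 0"
      by (auto simp: order_0I)
    have "[:-l, 1:] ^ order l m dvd r"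
    proof (cases "r = 0")
      case False
      then have "order l p = order l r" "p \<noteq> 0"
        using P order_mult[of ?P r l] by (simp_all only: p mult_eq_0_iff) auto
      then show ?thesis
        using assms(2)[of l] by (simp add: order_divides)
    qed simp
    then show ?case
      using insert.hyps by (simp add: p mult.commute[of ?P] mult_dvd_mono)
  qed simp
  then have "(\<Prod>z | poly m z = 0. [:-z, 1:] ^ order z m) dvd p" using fin by blast
  then show ?thesis
    using assms(1) by (subst complex_poly_decompose[of m, symmetric]) (simp add: smult_dvd)
qed

lemma higher_deriv_poly: "(deriv ^^ j) (poly p) z = poly ((pderiv ^^ j) p) z" for p :: "complex poly"
proof (induction j arbitrary: z)
  case (Suc j)
  have "(deriv ^^ j) (poly p) = poly ((pderiv ^^ j) p)" using Suc by auto
  then show ?case by (simp add: DERIV_imp_deriv poly_DERIV)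
qed simp

text \<open>The working criterion for values of \<open>mat_fun\<close>: if \<open>F - p\<close> is a holomorphic multiple of the minimal
  polynomial, then by Leibniz's rule \<open>p\<close> has the required derivatives. Any other interpolant differs
  from \<open>p\<close> by a polynomial that the minimal polynomial divides, hence has the same value at \<open>A\<close>.\<close>
lemma mat_fun_eqI:
  assumes S: "open S" "\<And>l. poly (minpoly A) l = 0 \<Longrightarrow> l \<in> S"
    and h: "h holomorphic_on S"
    and F: "\<And>z. z \<in> S \<Longrightarrow> F z = poly p z + poly (minpoly A) z * h z"
  shows "mat_fun F A = mat_poly p A"
proof -
  let ?m = "minpoly A"
  have hp: "poly q holomorphic_on S" for q :: "complex poly"
    by (intro holomorphic_intros)
  have ev: "(deriv ^^ j) F l = poly ((pderiv ^^ j) p) l" if j: "j < order l ?m" for l j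
  proof -
    have l: "l \<in> S" using j S(2) by (metis order_root not_less_zero)
    have "(deriv ^^ j) F l = (deriv ^^ j) (\<lambda>z. poly p z + poly ?m z * h z) l"
      using S(1) l hp h F
      by (intro higher_deriv_transform_within_open[of _ S])
         (auto intro!: holomorphic_intros simp: holomorphic_transform
           intro: holomorphic_transform[of "\<lambda>z. poly p z + poly ?m z * h z"])
    also have "\<dots> = (deriv ^^ j) (poly p) l + (deriv ^^ j) (\<lambda>z. poly ?m z * h z) l"
      using S(1) l hp h by (intro higher_deriv_add[of _ S]) (auto intro!: holomorphic_intros)
    also have "(deriv ^^ j) (\<lambda>z. poly ?m z * h z) l = 0"
      using higher_deriv_mult[OF hp h S(1) l, of j ?m] j
      by (simp add: higher_deriv_poly higher_pderiv_root)
    finally show ?thesis by (simp add: higher_deriv_poly)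
  qed
  define q where "q = (SOME p. interpolates_on_spectrum p F A)"
  have "interpolates_on_spectrum p F A"
    by (simp add: interpolates_on_spectrum_def ev)
  then have q: "interpolates_on_spectrum q F A"
    unfolding q_def by (rule someI)
  have dist: "(pderiv ^^ j) (q - p) = (pderiv ^^ j) q - (pderiv ^^ j) p" for j
    by (induction j) (simp_all add: pderiv_diff)
  have "?m dvd q - p"
  proof (rule dvd_if_order_le[OF minpoly_nonzero], rule power_dvd_if_higher_pderivs_vanish)
    fix l j assume "j < order l ?m"
    then show "poly ((pderiv ^^ j) (q - p)) l = 0"
      using q ev by (simp add: dist interpolates_on_spectrum_def)
  qed
  then obtain r where "q - p = ?m * r" by auto
  then have "mat_poly (q - p) A = 0"
    by (simp add: mat_poly_mult mat_poly_minpoly matrix_mult.zero_left)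
  then show ?thesis
    by (simp add: mat_fun_def q_def mat_poly_diff)
qed

section \<open>Derivatives of Stieltjes transforms\<close>

lemma borel_measurable_if_continuous_on_nonneg:
  fixes f :: "real \<Rightarrow> 'b::topological_space"
  assumes "sets \<mu> = sets (restrict_space borel {0..})" "continuous_on {0..} f"
  shows "f \<in> borel_measurable \<mu>"
  using borel_measurable_continuous_on_restrict[OF assms(2)] measurable_cong_sets[OF assms(1) refl]
  by auto

lemma space_nonneg:
  assumes "sets \<mu> = sets (restrict_space borel {0::real..})"
  shows "space \<mu> = {0..}"
  using sets_eq_imp_space_eq[OF assms] by (simp add: space_restrict_space)

lemma integrable_if_continuous_dominated:
  fixes f :: "real \<Rightarrow> 'b::{banach,second_countable_topology}" and B :: "real \<Rightarrow> real"
  assumes "sets \<mu> = sets (restrict_space borel {0..})" "integrable \<mu> B" "continuous_on {0..} f"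
    and "\<And>t. 0 \<le> t \<Longrightarrow> norm (f t) \<le> K * B t"
  shows "integrable \<mu> f"
proof (rule Bochner_Integration.integrable_bound)
  show "integrable \<mu> (\<lambda>t. K * B t)" using assms(2) by simp
  show "f \<in> borel_measurable \<mu>"
    by (rule borel_measurable_if_continuous_on_nonneg[OF assms(1,3)])
  show "AE t in \<mu>. norm (f t) \<le> norm (K * B t)"
    using assms(4) by (intro AE_I2) (force simp: space_nonneg[OF assms(1)])
qed

lemma norm_inverse_shift_le:
  assumes "0 \<le> t" "0 < d" "d \<le> 1" "d \<le> Re z"
  shows "cmod (1 / (complex_of_real t + z)) \<le> 1 / (d * (1 + t))"
proof -
  have "d * t \<le> t" using assms by (simp add: mult_left_le_one_le)
  then have "d * (1 + t) \<le> Re (complex_of_real t + z)"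
    using assms by (simp add: algebra_simps)
  also have "\<dots> \<le> cmod (complex_of_real t + z)" by (rule complex_Re_le_cmod)
  finally show ?thesis
    using assms by (simp add: norm_divide frac_le)
qed

lemma shift_nonzero: "0 \<le> t \<Longrightarrow> 0 < Re z \<Longrightarrow> complex_of_real t + z \<noteq> 0"
  by (metis Re_complex_of_real add_eq_0_iff add_pos_nonneg add.commute less_irrefl plus_complex.simps(1) zero_complex.simps(1))

lemma has_field_derivative_if_quadratic_remainder:
  fixes F :: "complex \<Rightarrow> complex"
  assumes "0 < r" and "\<And>h. cmod h < r \<Longrightarrow> cmod (F (z + h) - F z - h * D) \<le> K * (cmod h)\<^sup>2"
  shows "(F has_field_derivative D) (at z)"
proof -
  have "((\<lambda>h. (F (z + h) - F z) / h - D) \<longlongrightarrow> 0) (at 0)"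
  proof (rule Lim_null_comparison)
    show "\<forall>\<^sub>F h in at 0. cmod ((F (z + h) - F z) / h - D) \<le> K * cmod h"
      unfolding eventually_at
    proof (intro exI[of _ r] conjI ballI impI)
      fix h :: complex assume h: "h \<noteq> 0 \<and> dist h 0 < r"
      then have "cmod ((F (z + h) - F z) / h - D) = cmod (F (z + h) - F z - h * D) / cmod h"
        by (simp add: field_simps flip: norm_divide)
      also have "\<dots> \<le> K * (cmod h)\<^sup>2 / cmod h"
        using h assms(2)[of h] by (intro divide_right_mono) auto
      finally show "cmod ((F (z + h) - F z) / h - D) \<le> K * cmod h"
        using h by (simp add: power2_eq_square)
    qed (rule assms(1))
    show "((\<lambda>h. K * cmod h) \<longlongrightarrow> 0) (at 0)"
      by (auto intro!: tendsto_eq_intros)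
  qed
  then show ?thesis by (simp add: DERIV_def LIM_zero_iff)
qed

lemma integral_diff_add_mult:
  fixes f g k :: "_ \<Rightarrow> complex"
  assumes "integrable M f" "integrable M g" "integrable M k"
  shows "integrable M (\<lambda>t. f t - g t + c * k t)"
    and "(LINT t|M. f t - g t + c * k t) = (LINT t|M. f t) - (LINT t|M. g t) + c * (LINT t|M. k t)"
  using assms by simp_all

lemma norm_triple_le:
  fixes a b c w :: complex
  assumes "cmod a \<le> r" "cmod b \<le> r" "cmod c \<le> r"
  shows "cmod (w * (a * b * c)) \<le> cmod w * r ^ 3"
proof -
  have "0 \<le> r" using assms(1) norm_ge_zero order_trans by blast
  then have "cmod a * cmod b * cmod c \<le> r * r * r"
    using assms by (intro mult_mono) auto
  then show ?thesis by (simp add: norm_mult power3_eq_cube mult_left_mono)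
qed

lemma inverse_shift_cube_le:
  fixes t d :: real
  assumes "0 \<le> t" "0 < d" "d \<le> 1"
  shows "(1 / (d * (1 + t))) ^ 3 \<le> 1 / d ^ 3 * (1 / (1 + t)\<^sup>2)"
proof -
  have "1 / (1 + t) ^ 3 \<le> 1 / (1 + t)\<^sup>2"
    using assms power_increasing[of 2 3 "1 + t"] by (intro frac_le) auto
  then have "1 / d ^ 3 * (1 / (1 + t) ^ 3) \<le> 1 / d ^ 3 * (1 / (1 + t)\<^sup>2)"
    using assms by (intro mult_left_mono) auto
  then show ?thesis
    by (simp add: power_divide power_mult_distrib)
qed

text \<open>For \<open>w(t) = t\<close> the integral of \<open>w(t) / (t + z)\<close> may diverge. What converges is the integral of
  \<open>w(t) / (1 + t)\<^sup>2\<close>, hence that of a difference of two kernels, and this is all the derivatives see.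
  The weight is complex because \<open>1 / m(-t)\<close> for a complex polynomial \<open>m\<close> also occurs.\<close>
context
  fixes \<mu> :: "real measure" and w :: "real \<Rightarrow> complex"
  assumes sets: "sets \<mu> = sets (restrict_space borel {0..})"
    and cont: "continuous_on {0..} w"
    and int: "integrable \<mu> (\<lambda>t. cmod (w t) / (1 + t)\<^sup>2)"
begin

lemma integrable_inverse_shift_square:
  assumes "0 < Re z"
  shows "integrable \<mu> (\<lambda>t. w t / (complex_of_real t + z)\<^sup>2)"
proof (rule integrable_if_continuous_dominated[OF sets int])
  show "continuous_on {0..} (\<lambda>t. w t / (complex_of_real t + z)\<^sup>2)"
    using shift_nonzero assms by (intro continuous_intros cont) auto
  fix t :: real assume t: "0 \<le> t"
  define d where "d = min 1 (Re z)"
  have "cmod (1 / (complex_of_real t + z)) \<le> 1 / (d * (1 + t))"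
    using assms t by (intro norm_inverse_shift_le) (auto simp: d_def)
  then have "(cmod (1 / (complex_of_real t + z)))\<^sup>2 \<le> (1 / (d * (1 + t)))\<^sup>2"
    by (intro power_mono) auto
  then have "cmod (w t) * (cmod (1 / (complex_of_real t + z)))\<^sup>2 \<le> cmod (w t) * (1 / (d * (1 + t)))\<^sup>2"
    by (rule mult_left_mono) simp
  then show "cmod (w t / (complex_of_real t + z)\<^sup>2)
      \<le> 1 / (min 1 (Re z))\<^sup>2 * (cmod (w t) / (1 + t)\<^sup>2)"
    by (simp add: norm_divide norm_power power_divide power_mult_distrib d_def[symmetric])
qed

lemma integrable_inverse_shift_diff:
  assumes "0 < Re z" "0 < Re y"
  shows "integrable \<mu> (\<lambda>t. w t * (1 / (complex_of_real t + z) - 1 / (complex_of_real t + y)))"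
proof (rule integrable_if_continuous_dominated[OF sets int])
  show "continuous_on {0..} (\<lambda>t. w t * (1 / (complex_of_real t + z) - 1 / (complex_of_real t + y)))"
    using shift_nonzero assms by (intro continuous_intros cont) auto
  fix t :: real assume t: "0 \<le> t"
  define d where "d = min 1 (min (Re z) (Re y))"
  have d: "0 < d" using assms by (auto simp: d_def)
  have b: "cmod (1 / (complex_of_real t + z)) \<le> 1 / (d * (1 + t))"
      "cmod (1 / (complex_of_real t + y)) \<le> 1 / (d * (1 + t))"
    using assms t by (auto intro!: norm_inverse_shift_le simp: d_def)
  have "1 / (complex_of_real t + z) - 1 / (complex_of_real t + y)
      = (y - z) * (1 / (complex_of_real t + z) * (1 / (complex_of_real t + y)))"
    using shift_nonzero[OF t] assms by (simp add: field_simps)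
  then have "cmod (w t * (1 / (complex_of_real t + z) - 1 / (complex_of_real t + y)))
      = cmod (w t) * cmod (y - z) *
        (cmod (1 / (complex_of_real t + z)) * cmod (1 / (complex_of_real t + y)))"
    by (simp only: norm_mult mult.assoc)
  also have "\<dots> \<le> cmod (w t) * cmod (y - z) * (1 / (d * (1 + t)) * (1 / (d * (1 + t))))"
    using b d t by (intro mult_left_mono mult_mono) auto
  also have "\<dots> = cmod (y - z) / d\<^sup>2 * (cmod (w t) / (1 + t)\<^sup>2)"
    by (simp add: power2_eq_square mult_ac)
  finally show "cmod (w t * (1 / (complex_of_real t + z) - 1 / (complex_of_real t + y)))
      \<le> cmod (y - z) / (min 1 (min (Re z) (Re y)))\<^sup>2 * (cmod (w t) / (1 + t)\<^sup>2)"
    by (simp add: d_def)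
qed

lemma integrable_inverse_shift_triple:
  assumes "0 < Re x" "0 < Re y" "0 < Re z"
  shows "integrable \<mu> (\<lambda>t. w t *
      (1 / (complex_of_real t + x) * (1 / (complex_of_real t + y)) * (1 / (complex_of_real t + z))))"
    (is "integrable \<mu> ?f")
    and "0 < d \<Longrightarrow> d \<le> 1 \<Longrightarrow> d \<le> Re x \<Longrightarrow> d \<le> Re y \<Longrightarrow> d \<le> Re z \<Longrightarrow>
      cmod (LINT t|\<mu>. w t * (1 / (complex_of_real t + x) * (1 / (complex_of_real t + y)) *
        (1 / (complex_of_real t + z))))
      \<le> 1 / d ^ 3 * (LINT t|\<mu>. cmod (w t) / (1 + t)\<^sup>2)"
proof -
  have bound: "cmod (?f t) \<le> 1 / d ^ 3 * (cmod (w t) / (1 + t)\<^sup>2)"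
    if "0 < d" "d \<le> 1" "d \<le> Re x" "d \<le> Re y" "d \<le> Re z" "0 \<le> t" for d t
  proof -
    have "cmod (?f t) \<le> cmod (w t) * (1 / (d * (1 + t))) ^ 3"
      using that by (intro norm_triple_le norm_inverse_shift_le) auto
    also have "\<dots> \<le> cmod (w t) * (1 / d ^ 3 * (1 / (1 + t)\<^sup>2))"
      using that by (intro mult_left_mono inverse_shift_cube_le) auto
    finally show ?thesis by simp
  qed
  show f: "integrable \<mu> ?f"
  proof (rule integrable_if_continuous_dominated[OF sets int])
    show "continuous_on {0..} ?f"
      using shift_nonzero assms by (intro continuous_intros cont) auto
    show "cmod (?f t) \<le> 1 / (Min {1, Re x, Re y, Re z}) ^ 3 * (cmod (w t) / (1 + t)\<^sup>2)"
      if "0 \<le> t" for t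
      using that assms by (intro bound) auto
  qed
  assume d: "0 < d" "d \<le> 1" "d \<le> Re x" "d \<le> Re y" "d \<le> Re z"
  have "cmod (LINT t|\<mu>. ?f t) \<le> (LINT t|\<mu>. cmod (?f t))" by simp
  also have "\<dots> \<le> (LINT t|\<mu>. 1 / d ^ 3 * (cmod (w t) / (1 + t)\<^sup>2))"
  proof (rule integral_mono)
    show "integrable \<mu> (\<lambda>t. 1 / d ^ 3 * (cmod (w t) / (1 + t)\<^sup>2))"
      by (rule integrable_mult_right[OF int])
  qed (use f d bound in \<open>auto simp: space_nonneg[OF sets]\<close>)
  finally show "cmod (LINT t|\<mu>. ?f t) \<le> 1 / d ^ 3 * (LINT t|\<mu>. cmod (w t) / (1 + t)\<^sup>2)"
    by (simp only: integral_mult_right_zero)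
qed

text \<open>With \<open>a = 1 / (t + z + h)\<close> and \<open>b = 1 / (t + z)\<close> the Taylor remainder of the kernel is exactly
  \<open>a - b + h b\<^sup>2 = h\<^sup>2 a b\<^sup>2\<close>, which is integrable uniformly in small \<open>h\<close>.\<close>
lemma deriv_stieltjes_transform:
  assumes z: "0 < Re z" and y: "0 < Re y"
  shows "((\<lambda>z. LINT t|\<mu>. w t * (1 / (complex_of_real t + z) - 1 / (complex_of_real t + y)))
    has_field_derivative - (LINT t|\<mu>. w t / (complex_of_real t + z)\<^sup>2)) (at z)"
    (is "(?F has_field_derivative - ?D) _")
proof -
  define d where "d = min 1 (Re z / 2)"
  have d: "0 < d" "d \<le> 1" "2 * d \<le> Re z" using z by (auto simp: d_def)
  show ?thesis
  proof (rule has_field_derivative_if_quadratic_remainder[OF d(1)])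
    fix h assume h: "cmod h < d"
    then have "\<bar>Re h\<bar> < d" using abs_Re_le_cmod[of h] by linarith
    then have zh: "d \<le> Re (z + h)" using d by simp
    define a where "a t = 1 / (complex_of_real t + (z + h))" for t
    define b where "b t = 1 / (complex_of_real t + z)" for t
    define c where "c t = 1 / (complex_of_real t + y)" for t
    have ab: "a t - b t + h * (b t * b t) = h\<^sup>2 * (a t * b t * b t)" if "0 \<le> t" for t
    proof -
      have nz: "complex_of_real t + (z + h) \<noteq> 0" "complex_of_real t + z \<noteq> 0"
        using shift_nonzero that z zh d(1) by auto
      have "a t - b t = - h * (a t * b t)"
        using nz by (simp add: a_def b_def field_simps)
      then show ?thesis by algebra
    qed
    have b2: "w t / (complex_of_real t + z)\<^sup>2 = w t * (b t * b t)" for t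
      by (simp add: b_def power2_eq_square)
    have i: "integrable \<mu> (\<lambda>t. w t * (a t - c t))" "integrable \<mu> (\<lambda>t. w t * (b t - c t))"
      unfolding a_def b_def c_def using z y zh d(1) by (auto intro!: integrable_inverse_shift_diff)
    have ib: "integrable \<mu> (\<lambda>t. w t * (b t * b t))"
      using integrable_inverse_shift_square[OF z] by (simp only: b2)
    have "?F (z + h) - ?F z - h * - ?D
        = (LINT t|\<mu>. w t * (a t - c t)) - (LINT t|\<mu>. w t * (b t - c t))
          + h * (LINT t|\<mu>. w t * (b t * b t))"
      by (simp only: b2 a_def b_def c_def) simp
    also have "\<dots> = (LINT t|\<mu>. w t * (a t - c t) - w t * (b t - c t) + h * (w t * (b t * b t)))"
      using i ib by simp
    also have "\<dots> = (LINT t|\<mu>. h\<^sup>2 * (w t * (a t * b t * b t)))"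
    proof (rule Bochner_Integration.integral_cong[OF refl])
      fix t assume "t \<in> space \<mu>"
      then have t: "0 \<le> t" by (simp add: space_nonneg[OF sets])
      have "w t * (a t - c t) - w t * (b t - c t) + h * (w t * (b t * b t))
          = w t * (a t - b t + h * (b t * b t))" by (simp add: algebra_simps)
      then show "w t * (a t - c t) - w t * (b t - c t) + h * (w t * (b t * b t))
          = h\<^sup>2 * (w t * (a t * b t * b t))" by (simp add: ab[OF t])
    qed
    also have "cmod \<dots> = (cmod h)\<^sup>2 * cmod (LINT t|\<mu>. w t * (a t * b t * b t))"
      by (simp add: norm_mult norm_power)
    also have "\<dots> \<le> (cmod h)\<^sup>2 * (1 / d ^ 3 * (LINT t|\<mu>. cmod (w t) / (1 + t)\<^sup>2))"
      unfolding a_def b_def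
      using z zh d by (intro mult_left_mono integrable_inverse_shift_triple(2)) auto
    finally show "cmod (?F (z + h) - ?F z - h * - ?D)
        \<le> 1 / d ^ 3 * (LINT t|\<mu>. cmod (w t) / (1 + t)\<^sup>2) * (cmod h)\<^sup>2"
      by (simp add: mult.commute)
  qed
qed

text \<open>The same argument; here the remainder is \<open>a\<^sup>2 - b\<^sup>2 + 2 h b\<^sup>3 = h\<^sup>2 a b\<^sup>2 (2 b + a)\<close>.\<close>
lemma deriv2_stieltjes_transform:
  assumes z: "0 < Re z"
  shows "((\<lambda>z. LINT t|\<mu>. w t / (complex_of_real t + z)\<^sup>2)
    has_field_derivative - 2 * (LINT t|\<mu>. w t / (complex_of_real t + z) ^ 3)) (at z)"
    (is "(?F has_field_derivative - 2 * ?D) _")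
proof -
  define d where "d = min 1 (Re z / 2)"
  have d: "0 < d" "d \<le> 1" "2 * d \<le> Re z" using z by (auto simp: d_def)
  let ?I = "LINT t|\<mu>. cmod (w t) / (1 + t)\<^sup>2"
  show ?thesis
  proof (rule has_field_derivative_if_quadratic_remainder[OF d(1)])
    fix h assume h: "cmod h < d"
    then have "\<bar>Re h\<bar> < d" using abs_Re_le_cmod[of h] by linarith
    then have zh: "d \<le> Re (z + h)" using d by simp
    define a where "a t = 1 / (complex_of_real t + (z + h))" for t
    define b where "b t = 1 / (complex_of_real t + z)" for t
    have b3: "w t / (complex_of_real t + z) ^ 3 = w t * (b t * b t * b t)" for t
      by (simp add: b_def power3_eq_cube)
    have int3: "integrable \<mu> (\<lambda>t. w t / (complex_of_real t + z) ^ 3)"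
      unfolding b3 unfolding b_def by (rule integrable_inverse_shift_triple(1)[OF z z z])
    have ab: "a t * a t - b t * b t + 2 * h * (b t * b t * b t)
        = h\<^sup>2 * (a t * b t * b t * (2 * b t + a t))" if "0 \<le> t" for t
    proof -
      have nz: "complex_of_real t + (z + h) \<noteq> 0" "complex_of_real t + z \<noteq> 0"
        using shift_nonzero that z zh d(1) by auto
      have "a t - b t = - h * (a t * b t)"
        using nz by (simp add: a_def b_def field_simps)
      then show ?thesis by algebra
    qed
    have i: "integrable \<mu> (\<lambda>t. w t / (complex_of_real t + (z + h))\<^sup>2)"
      using zh d(1) by (intro integrable_inverse_shift_square) auto
    note i = integral_diff_add_mult[OF i integrable_inverse_shift_square[OF z] int3, of "2 * h"]
    have "?F (z + h) - ?F z - h * (- 2 * ?D) = ?F (z + h) - ?F z + 2 * h * ?D" by simp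
    also have "\<dots> = (LINT t|\<mu>. w t / (complex_of_real t + (z + h))\<^sup>2 - w t / (complex_of_real t + z)\<^sup>2
            + 2 * h * (w t / (complex_of_real t + z) ^ 3))"
      by (rule i(2)[symmetric])
    also have "cmod \<dots> \<le> (LINT t|\<mu>. 3 * (cmod h)\<^sup>2 / d ^ 4 * (cmod (w t) / (1 + t)\<^sup>2))"
    proof (rule Bochner_Integration.integral_norm_bound_integral)
      show "integrable \<mu> (\<lambda>t. w t / (complex_of_real t + (z + h))\<^sup>2 - w t / (complex_of_real t + z)\<^sup>2
            + 2 * h * (w t / (complex_of_real t + z) ^ 3))"
        by (rule i(1))
      show "integrable \<mu> (\<lambda>t. 3 * (cmod h)\<^sup>2 / d ^ 4 * (cmod (w t) / (1 + t)\<^sup>2))"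
        by (rule integrable_mult_right[OF int])
      fix t assume "t \<in> space \<mu>"
      then have t: "0 \<le> t" by (simp add: space_nonneg[OF sets])
      define r where "r = 1 / (d * (1 + t))"
      have r: "cmod (a t) \<le> r" "cmod (b t) \<le> r" "0 \<le> r"
        unfolding a_def b_def r_def using z zh d t by (auto intro!: norm_inverse_shift_le)
      have "w t / (complex_of_real t + (z + h))\<^sup>2 - w t / (complex_of_real t + z)\<^sup>2
            + 2 * h * (w t / (complex_of_real t + z) ^ 3)
          = w t * (a t * a t - b t * b t + 2 * h * (b t * b t * b t))"
        by (simp add: a_def b_def power2_eq_square power3_eq_cube algebra_simps)
      also have "\<dots> = (w t * (a t * b t * b t)) * (h\<^sup>2 * (2 * b t + a t))"
        by (simp add: ab[OF t])
      finally have eq: "cmod (w t / (complex_of_real t + (z + h))\<^sup>2 - w t / (complex_of_real t + z)\<^sup>2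
            + 2 * h * (w t / (complex_of_real t + z) ^ 3))
          = cmod (w t * (a t * b t * b t)) * ((cmod h)\<^sup>2 * cmod (2 * b t + a t))"
        by (simp only: norm_mult norm_power)
      have "cmod (2 * b t + a t) \<le> cmod (2 * b t) + cmod (a t)" by (rule norm_triangle_ineq)
      also have "\<dots> \<le> 3 * r" using r by simp
      also have "\<dots> \<le> 3 / d" using d t by (simp add: r_def frac_le)
      finally have "cmod (w t * (a t * b t * b t)) * ((cmod h)\<^sup>2 * cmod (2 * b t + a t))
          \<le> (cmod (w t) * r ^ 3) * ((cmod h)\<^sup>2 * (3 / d))"
        using r d by (intro mult_mono mult_left_mono norm_triple_le) auto
      also have "\<dots> \<le> (cmod (w t) * (1 / d ^ 3 * (1 / (1 + t)\<^sup>2))) * ((cmod h)\<^sup>2 * (3 / d))"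
        unfolding r_def using d t
        by (intro mult_right_mono mult_left_mono inverse_shift_cube_le) auto
      also have "\<dots> = 3 * (cmod h)\<^sup>2 / d ^ 4 * (cmod (w t) / (1 + t)\<^sup>2)"
        by (simp add: power_numeral_reduce mult_ac)
      finally show "cmod (w t / (complex_of_real t + (z + h))\<^sup>2 - w t / (complex_of_real t + z)\<^sup>2
            + 2 * h * (w t / (complex_of_real t + z) ^ 3))
          \<le> 3 * (cmod h)\<^sup>2 / d ^ 4 * (cmod (w t) / (1 + t)\<^sup>2)"
        by (simp only: eq)
    qed
    also have "\<dots> = 3 / d ^ 4 * ?I * (cmod h)\<^sup>2"
      by (simp only: integral_mult_right_zero) simp
    finally show "cmod (?F (z + h) - ?F z - h * (- 2 * ?D)) \<le> 3 / d ^ 4 * ?I * (cmod h)\<^sup>2" .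
  qed
qed

end

section \<open>Stieltjes functions of accretive matrices\<close>

lemma stieltjes_measureE:
  assumes "stieltjes g"
  obtains \<mu> where "sets \<mu> = sets (restrict_space borel {0::real..})"
    and "integrable \<mu> (\<lambda>t. 1 / (1 + t))"
    and "\<And>z. 0 < Re z \<Longrightarrow> integrable \<mu> (\<lambda>t. 1 / (complex_of_real t + z))"
    and "\<And>z. 0 < Re z \<Longrightarrow> g z = (LINT t|\<mu>. 1 / (complex_of_real t + z))"
proof -
  obtain \<mu> :: "real measure" where sets: "sets \<mu> = sets (restrict_space borel {0..})"
    and g: "\<And>z. z \<notin> \<real>\<^sub>\<le>\<^sub>0 \<Longrightarrow> integrable \<mu> (\<lambda>t. 1 / (complex_of_real t + z)) \<and>
        g z = (LINT t|\<mu>. 1 / (complex_of_real t + z))"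
    using assms unfolding stieltjes_def by blast
  have pos: "z \<notin> \<real>\<^sub>\<le>\<^sub>0" if "0 < Re z" for z
    using that by (auto simp: complex_nonpos_Reals_iff)
  have "integrable \<mu> (\<lambda>t. cmod (1 / (complex_of_real t + 1)))"
    using g[of 1] pos[of 1] by (intro integrable_norm) auto
  also have "?this \<longleftrightarrow> integrable \<mu> (\<lambda>t. 1 / (1 + t))"
  proof (rule Bochner_Integration.integrable_cong[OF refl])
    fix t assume "t \<in> space \<mu>"
    then have "0 \<le> t" by (simp add: space_nonneg[OF sets])
    moreover have "complex_of_real t + 1 = complex_of_real (1 + t)" by simp
    ultimately show "cmod (1 / (complex_of_real t + 1)) = 1 / (1 + t)"
      by (simp only: norm_divide norm_of_real norm_one)
  qed
  finally show ?thesis using that sets g pos by blast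
qed
lemma norm_monic_poly_ge:
  fixes p :: "complex poly"
  assumes "lead_coeff p = 1" "\<And>l. poly p l = 0 \<Longrightarrow> c \<le> Re l" "0 \<le> t + c"
  shows "(t + c) ^ degree p \<le> cmod (poly p (- complex_of_real t))"
proof -
  have "p \<noteq> 0" using assms(1) by auto
  obtain R where R: "smult (lead_coeff p) (\<Prod>i<degree p. [:- R i, 1:]) = p"
    by (rule complex_poly_decompose')
  have p: "poly p z = (\<Prod>i<degree p. z - R i)" for z
    using arg_cong[OF R, of "\<lambda>q. poly q z"] assms(1) by (simp add: poly_prod)
  have "(\<Prod>i<degree p. t + c) \<le> (\<Prod>i<degree p. cmod (- complex_of_real t - R i))"
  proof (rule prod_mono)
    fix i assume "i \<in> {..<degree p}"
    then have "poly p (R i) = 0" by (auto simp: p)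
    then have "t + c \<le> Re (complex_of_real t + R i)" using assms(2) by simp
    also have "\<dots> \<le> cmod (complex_of_real t + R i)" by (rule complex_Re_le_cmod)
    also have "\<dots> = cmod (- complex_of_real t - R i)"
      by (metis minus_add_distrib norm_minus_cancel uminus_add_conv_diff diff_conv_add_uminus)
    finally show "0 \<le> t + c \<and> t + c \<le> cmod (- complex_of_real t - R i)"
      using assms(3) by simp
  qed
  then show ?thesis by (simp add: p prod_norm)
qed

lemma norm_poly_le_power:
  fixes q :: "complex poly"
  shows "\<exists>C. \<forall>t\<ge>0. cmod (poly q (- complex_of_real t)) \<le> C * (1 + t) ^ degree q"
proof (intro exI allI impI)
  fix t :: real assume t: "0 \<le> t"
  have "cmod (poly q (- complex_of_real t))
      \<le> (\<Sum>i\<le>degree q. cmod (coeff q i * (- complex_of_real t) ^ i))"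
    unfolding poly_altdef by (rule norm_sum)
  also have "\<dots> \<le> (\<Sum>i\<le>degree q. cmod (coeff q i) * (1 + t) ^ degree q)"
  proof (rule sum_mono)
    fix i assume i: "i \<in> {..degree q}"
    have "t ^ i \<le> (1 + t) ^ i" using t by (intro power_mono) auto
    also have "\<dots> \<le> (1 + t) ^ degree q" using t i by (intro power_increasing) auto
    finally show "cmod (coeff q i * (- complex_of_real t) ^ i) \<le> cmod (coeff q i) * (1 + t) ^ degree q"
      using t by (simp add: norm_mult norm_power mult_left_mono)
  qed
  also have "\<dots> = (\<Sum>i\<le>degree q. cmod (coeff q i)) * (1 + t) ^ degree q"
    by (simp add: sum_distrib_right)
  finally show "cmod (poly q (- complex_of_real t))
      \<le> (\<Sum>i\<le>degree q. cmod (coeff q i)) * (1 + t) ^ degree q" .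
qed

lemma coeff_synthetic_div_poly:
  "\<exists>q. (q = 0 \<or> degree q < degree m) \<and> (\<forall>c. coeff (synthetic_div m c) i = poly q c)"
  for m :: "complex poly"
proof (induction m arbitrary: i)
  case (pCons a m)
  show ?case
  proof (cases i)
    case 0
    then show ?thesis by (intro exI[of _ m]) auto
  next
    case (Suc j)
    obtain q where q: "q = 0 \<or> degree q < degree m" "\<forall>c. coeff (synthetic_div m c) j = poly q c"
      using pCons.IH by blast
    then show ?thesis
      using Suc by (intro exI[of _ q]) auto
  qed
qed (auto intro: exI[of _ 0])

text \<open>As functions of \<open>c\<close>, the coefficients of the quotient of \<open>m\<close> by \<open>z - c\<close> have smaller degree
  than \<open>m\<close>. After division by \<open>m(-t)\<close> they are therefore dominated by \<open>1 / (1 + t)\<close>, the function that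
  a Stieltjes measure integrates.\<close>
lemma coeff_synthetic_div_bound:
  fixes m :: "complex poly"
  assumes m: "lead_coeff m = 1" "\<And>l. poly m l = 0 \<Longrightarrow> c \<le> Re l" and c: "0 < c"
  shows "\<exists>C. \<forall>t\<ge>0. cmod (coeff (synthetic_div m (- complex_of_real t)) i / poly m (- complex_of_real t))
    \<le> C * (1 / (1 + t))"
proof -
  obtain q where q: "q = 0 \<or> degree q < degree m"
      "\<And>c. coeff (synthetic_div m c) i = poly q c"
    using coeff_synthetic_div_poly by blast
  show ?thesis
  proof (cases "q = 0")
    case True
    then show ?thesis by (intro exI[of _ 0]) (simp add: q(2))
  next
    case False
    obtain C where C: "\<And>t. 0 \<le> t \<Longrightarrow> cmod (poly q (- complex_of_real t)) \<le> C * (1 + t) ^ degree q"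
      using norm_poly_le_power by blast
    have C0: "0 \<le> C" using order_trans[OF norm_ge_zero C[of 0]] by simp
    define d where "d = min 1 c"
    have d: "0 < d" "d \<le> 1" "d \<le> c" using c by (auto simp: d_def)
    have "cmod (poly q (- complex_of_real t) / poly m (- complex_of_real t))
        \<le> C / d ^ degree m * (1 / (1 + t))" if t: "0 \<le> t" for t
    proof -
      have "d * t \<le> t" using d t by (simp add: mult_left_le_one_le)
      then have "(d * (1 + t)) ^ degree m \<le> (t + d) ^ degree m"
        using d t by (intro power_mono) (auto simp: algebra_simps)
      also have "\<dots> \<le> cmod (poly m (- complex_of_real t))"
        using m(2) d t by (intro norm_monic_poly_ge[OF m(1)]) (auto intro: order_trans)
      finally have den: "(d * (1 + t)) ^ degree m \<le> cmod (poly m (- complex_of_real t))" .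
      have "cmod (poly q (- complex_of_real t)) \<le> C * (1 + t) ^ degree q" by (rule C[OF t])
      also have "\<dots> \<le> C * (1 + t) ^ (degree m - 1)"
        using q(1) False C0 t by (intro mult_left_mono power_increasing) auto
      finally have num: "cmod (poly q (- complex_of_real t)) \<le> C * (1 + t) ^ (degree m - 1)" .
      have "cmod (poly q (- complex_of_real t) / poly m (- complex_of_real t))
          \<le> C * (1 + t) ^ (degree m - 1) / (d * (1 + t)) ^ degree m"
        unfolding norm_divide using num den d t C0 by (intro frac_le) auto
      also have "\<dots> = C / d ^ degree m * (1 / (1 + t))"
      proof -
        obtain k where "degree m = Suc k"
          using q(1) False by (cases "degree m") auto
        then show ?thesis using t by (simp add: power_mult_distrib)
      qed
      finally show ?thesis .
    qed
    then show ?thesis unfolding q(2) by blast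
  qed
qed

lemma bounded_linear_mat_mult: "bounded_linear (\<lambda>a. mat a ** M)" for M :: "complex ^ 'k ^ 'n"
  by (rule bounded_linear_intro[of _ "norm M"])
     (auto simp: vec_eq_iff mat_mult_entry algebra_simps norm_mat_mult)

text \<open>Let \<open>m\<close> be the minimal polynomial and let \<open>q\<^sub>t\<close> be the quotient of \<open>m\<close> by \<open>z + t\<close>, so that
  \<open>m(z) = (z + t) q\<^sub>t(z) + m(-t)\<close>. Then \<open>p\<^sub>t = - q\<^sub>t / m(-t)\<close> satisfies
  \<open>1 / (t + z) - p\<^sub>t(z) = m(z) / (m(-t) (t + z))\<close>, and substituting \<open>X\<close> gives \<open>(t + X) p\<^sub>t(X) = 1\<close>.
  Integrating over \<open>t\<close> yields \<open>p\<close> and the cofactor \<open>h(z) = \<integral> 1 / (m(-t) (t + z)) d\<mu>(t)\<close>.\<close>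
theorem stieltjes_interpolant:
  fixes X :: "complex ^ 'n ^ 'n"
  assumes sets: "sets \<mu> = sets (restrict_space borel {0..})"
    and int: "integrable \<mu> (\<lambda>t. 1 / (1 + t))"
    and g: "\<And>z. 0 < Re z \<Longrightarrow> g z = (LINT t|\<mu>. 1 / (complex_of_real t + z))"
    and X: "accretive c X" and c: "0 < c"
  obtains p h where "h holomorphic_on {z. 0 < Re z}"
    and "\<And>z. 0 < Re z \<Longrightarrow> g z = poly p z + poly (minpoly X) z * h z"
    and "integrable \<mu> (resolvent X)"
    and "mat_poly p X = (LINT t|\<mu>. resolvent X t)"
proof -
  define m where "m = minpoly X"
  have m: "lead_coeff m = 1" "\<And>l. poly m l = 0 \<Longrightarrow> c \<le> Re l"
    using minpoly_monic accretive_minpoly_root[OF X] by (auto simp: m_def)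
  have m0: "poly m (- complex_of_real t) \<noteq> 0" if "0 \<le> t" for t
    using m(2)[of "- complex_of_real t"] c that by auto
  define P where "P t = smult (- 1 / poly m (- complex_of_real t)) (synthetic_div m (- complex_of_real t))" for t
  have degP: "degree (P t) \<le> degree m" for t
    unfolding P_def by (rule order_trans[OF degree_smult_le]) (simp add: degree_synthetic_div)
  have coP: "continuous_on {0..} (\<lambda>t. coeff (P t) i)" and inP: "integrable \<mu> (\<lambda>t. coeff (P t) i)" for i
  proof -
    obtain q where q: "\<And>c. coeff (synthetic_div m c) i = poly q c"
      using coeff_synthetic_div_poly by blast
    show co: "continuous_on {0..} (\<lambda>t. coeff (P t) i)"
      using m0 by (auto simp: P_def q intro!: continuous_intros)
    obtain C where C: "\<And>t. 0 \<le> t \<Longrightarrow> cmod (coeff (synthetic_div m (- complex_of_real t)) i /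
        poly m (- complex_of_real t)) \<le> C * (1 / (1 + t))"
      using coeff_synthetic_div_bound[OF m c] by blast
    show "integrable \<mu> (\<lambda>t. coeff (P t) i)"
      using C by (intro integrable_if_continuous_dominated[OF sets int co, of C])
        (simp add: P_def norm_divide norm_mult)
  qed
  have sd: "(z + complex_of_real t) * poly (synthetic_div m (- complex_of_real t)) z
      + poly m (- complex_of_real t) = poly m z" for z t
    using arg_cong[OF synthetic_div_correct'[of "- complex_of_real t" m], of "\<lambda>q. poly q z"]
    by (simp add: algebra_simps)
  have PX: "mat_poly (P t) X = resolvent X t" if t: "0 \<le> t" for t
  proof -
    have "(mat (complex_of_real t) + X) ** mat_poly (synthetic_div m (- complex_of_real t)) X
        + mat (poly m (- complex_of_real t)) = mat_poly m X"
      using arg_cong[OF synthetic_div_correct'[of "- complex_of_real t" m], of "\<lambda>q. mat_poly q X"]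
      by (simp only: mat_poly_add mat_poly_mult mat_poly_linear mat_poly_const minus_minus)
    then have eq: "(mat (complex_of_real t) + X) ** mat_poly (synthetic_div m (- complex_of_real t)) X
        = - mat (poly m (- complex_of_real t))"
      by (simp add: m_def mat_poly_minpoly eq_neg_iff_add_eq_0)
    have "(mat (complex_of_real t) + X) ** mat_poly (P t) X
        = mat (- 1 / poly m (- complex_of_real t)) **
          ((mat (complex_of_real t) + X) ** mat_poly (synthetic_div m (- complex_of_real t)) X)"
      unfolding P_def mat_poly_smult by (metis matrix_mul_assoc mat_mult_commute)
    also have "\<dots> = mat 1"
      using m0[OF t] by (simp add: eq vec_eq_iff mat_mult_entry) (simp add: mat_def)
    finally show ?thesis
      using resolvent_eqI[OF X] c t by simp
  qed
  define p where "p = (\<Sum>i\<le>degree m. monom (LINT t|\<mu>. coeff (P t) i) i)"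
  have cop: "coeff p i = (if i \<le> degree m then (LINT t|\<mu>. coeff (P t) i) else 0)" for i
    by (simp add: p_def coeff_sum sum.delta)
  have degp: "degree p \<le> degree m" by (rule degree_le) (simp add: cop)
  define h where "h z = (LINT t|\<mu>. 1 / poly m (- complex_of_real t) * (1 / (complex_of_real t + z)))" for z
  obtain B where B: "\<And>t. 0 \<le> t \<Longrightarrow> cmod (1 / poly m (- complex_of_real t)) \<le> B"
  proof
    fix t :: real assume t: "0 \<le> t"
    have "c ^ degree m \<le> (t + c) ^ degree m" using c t by (intro power_mono) auto
    also have "\<dots> \<le> cmod (poly m (- complex_of_real t))"
      using c t m by (intro norm_monic_poly_ge) auto
    finally show "cmod (1 / poly m (- complex_of_real t)) \<le> 1 / c ^ degree m"
      using c by (simp add: norm_divide frac_le)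
  qed
  have cont_w: "continuous_on {0..} (\<lambda>t. 1 / poly m (- complex_of_real t))"
    using m0 by (auto intro!: continuous_intros)
  have B0: "0 \<le> B" using order_trans[OF norm_ge_zero B[of 0]] by simp
  have inth: "integrable \<mu> (\<lambda>t. 1 / poly m (- complex_of_real t) * (1 / (complex_of_real t + z)))"
    and intg: "integrable \<mu> (\<lambda>t. 1 / (complex_of_real t + z))"
    if z: "0 < Re z" for z
  proof -
    have nb: "cmod (1 / (complex_of_real t + z)) \<le> 1 / min 1 (Re z) * (1 / (1 + t))" if "0 \<le> t" for t
      using norm_inverse_shift_le[OF that, of "min 1 (Re z)" z] z by simp
    show "integrable \<mu> (\<lambda>t. 1 / (complex_of_real t + z))"
      by (rule integrable_if_continuous_dominated[OF sets int _ nb])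
         (use shift_nonzero z in \<open>auto intro!: continuous_intros\<close>)
    have "cmod (1 / poly m (- complex_of_real t) * (1 / (complex_of_real t + z)))
        \<le> B * (1 / min 1 (Re z) * (1 / (1 + t)))" if "0 \<le> t" for t
      unfolding norm_mult using B[OF that] nb[OF that] B0 by (intro mult_mono) auto
    then show "integrable \<mu> (\<lambda>t. 1 / poly m (- complex_of_real t) * (1 / (complex_of_real t + z)))"
      using shift_nonzero z
      by (intro integrable_if_continuous_dominated[OF sets int, of _ "B * (1 / min 1 (Re z))"]
          continuous_intros cont_w) (auto simp: mult.assoc)
  qed
  have hhol: "h holomorphic_on {z. 0 < Re z}"
  proof -
    have intw: "integrable \<mu> (\<lambda>t. cmod (1 / poly m (- complex_of_real t)) / (1 + t)\<^sup>2)"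
    proof (rule integrable_if_continuous_dominated[OF sets int])
      show "continuous_on {0..} (\<lambda>t. cmod (1 / poly m (- complex_of_real t)) / (1 + t)\<^sup>2)"
        by (intro continuous_intros cont_w) auto
      fix t :: real assume t: "0 \<le> t"
      have "1 / (1 + t)\<^sup>2 \<le> 1 / (1 + t)"
        using t power_increasing[of 1 2 "1 + t"] by (intro frac_le) auto
      then have "cmod (1 / poly m (- complex_of_real t)) * (1 / (1 + t)\<^sup>2) \<le> B * (1 / (1 + t))"
        using B[OF t] t B0 by (intro mult_mono) auto
      then show "norm (cmod (1 / poly m (- complex_of_real t)) / (1 + t)\<^sup>2) \<le> B * (1 / (1 + t))"
        by simp
    qed
    have "(h has_field_derivative - (LINT t|\<mu>. 1 / poly m (- complex_of_real t) / (complex_of_real t + z)\<^sup>2)) (at z)"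
      if z: "0 < Re z" for z
    proof (rule has_field_derivative_transform_within_open)
      show "((\<lambda>z. (LINT t|\<mu>. 1 / poly m (- complex_of_real t) *
            (1 / (complex_of_real t + z) - 1 / (complex_of_real t + 1))) + h 1)
          has_field_derivative - (LINT t|\<mu>. 1 / poly m (- complex_of_real t) / (complex_of_real t + z)\<^sup>2)) (at z)"
        using DERIV_add[OF deriv_stieltjes_transform[OF sets cont_w intw z, of 1] DERIV_const[of "h 1"]]
        by (simp only: add_0_right one_complex.sel zero_less_one simp_thms)
      show "open {z. 0 < Re z}" by (rule open_halfspace_Re_gt)
      show "(LINT t|\<mu>. 1 / poly m (- complex_of_real t) *
            (1 / (complex_of_real t + z) - 1 / (complex_of_real t + 1))) + h 1 = h z"
        if "z \<in> {z. 0 < Re z}" for z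
        using inth[of z] inth[of 1] that by (simp add: h_def right_diff_distrib)
    qed (use z in simp)
    then show ?thesis
      by (auto simp: holomorphic_on_def field_differentiable_def intro: has_field_derivative_at_within)
  qed
  have fin: "g z = poly p z + poly m z * h z" if z: "0 < Re z" for z
  proof -
    have "poly p z = (\<Sum>i\<le>degree m. (LINT t|\<mu>. coeff (P t) i) * z ^ i)"
      by (simp add: p_def poly_sum poly_monom)
    also have "\<dots> = (LINT t|\<mu>. (\<Sum>i\<le>degree m. coeff (P t) i * z ^ i))"
      using inP by simp
    finally have pz: "poly p z = (LINT t|\<mu>. (\<Sum>i\<le>degree m. coeff (P t) i * z ^ i))" .
    have "poly p z + poly m z * h z = (LINT t|\<mu>. (\<Sum>i\<le>degree m. coeff (P t) i * z ^ i)
        + poly m z * (1 / poly m (- complex_of_real t) * (1 / (complex_of_real t + z))))"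
      unfolding pz h_def integral_mult_right_zero[symmetric]
      by (rule Bochner_Integration.integral_add[symmetric])
         (intro Bochner_Integration.integrable_sum integrable_mult_left inP
           integrable_mult_right[OF inth[OF z]])+
    also have "\<dots> = (LINT t|\<mu>. 1 / (complex_of_real t + z))"
    proof (rule Bochner_Integration.integral_cong[OF refl])
      fix t assume "t \<in> space \<mu>"
      then have t: "0 \<le> t" by (simp add: space_nonneg[OF sets])
      have "(\<Sum>i\<le>degree m. coeff (P t) i * z ^ i) = poly (P t) z"
        unfolding poly_altdef using degP[of t]
        by (intro sum.mono_neutral_right) (auto simp: coeff_eq_0)
      also have "\<dots> = - poly (synthetic_div m (- complex_of_real t)) z / poly m (- complex_of_real t)"
        by (simp add: P_def)
      finally have sum: "(\<Sum>i\<le>degree m. coeff (P t) i * z ^ i)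
          = - poly (synthetic_div m (- complex_of_real t)) z / poly m (- complex_of_real t)" .
      have "- S / m1 + ((z + u) * S + m1) * (1 / m1 * (1 / (u + z))) = 1 / (u + z)"
        if "m1 \<noteq> 0" "u + z \<noteq> 0" for S m1 u :: complex
        using that by (simp add: divide_simps)
      then show "(\<Sum>i\<le>degree m. coeff (P t) i * z ^ i)
          + poly m z * (1 / poly m (- complex_of_real t) * (1 / (complex_of_real t + z)))
          = 1 / (complex_of_real t + z)"
        unfolding sum sd[of z t, symmetric] using m0[OF t] shift_nonzero[OF t z] by blast
    qed
    finally show ?thesis using g[OF z] by simp
  qed
  have bl: "integrable \<mu> (\<lambda>t. mat (coeff (P t) i) ** mat_pow X i)"
    "(LINT t|\<mu>. mat (coeff (P t) i) ** mat_pow X i) = mat (LINT t|\<mu>. coeff (P t) i) ** mat_pow X i" for i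
    using integrable_bounded_linear[OF bounded_linear_mat_mult inP]
      integral_bounded_linear[OF bounded_linear_mat_mult inP] by blast+
  have res: "resolvent X t = (\<Sum>i\<le>degree m. mat (coeff (P t) i) ** mat_pow X i)" if "t \<in> space \<mu>" for t
    unfolding mat_poly_eq_sum[OF degP, symmetric] using that PX[of t] by (simp add: space_nonneg[OF sets])
  have "integrable \<mu> (resolvent X)"
    by (subst Bochner_Integration.integrable_cong[OF refl res]) (auto intro: bl)
  moreover have "mat_poly p X = (LINT t|\<mu>. resolvent X t)"
    by (subst Bochner_Integration.integral_cong[OF refl res])
       (auto simp: mat_poly_eq_sum[OF degp] cop bl)
  ultimately show ?thesis
    using that[OF hhol fin[unfolded m_def]] by blast
qed

lemma mat_fun_stieltjes:
  fixes X :: "complex ^ 'n ^ 'n"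
  assumes sets: "sets \<mu> = sets (restrict_space borel {0..})"
    and int: "integrable \<mu> (\<lambda>t. 1 / (1 + t))"
    and g: "\<And>z. 0 < Re z \<Longrightarrow> g z = (LINT t|\<mu>. 1 / (complex_of_real t + z))"
    and X: "accretive c X" and c: "0 < c"
  shows "integrable \<mu> (resolvent X)"
    and "mat_fun g X = (LINT t|\<mu>. resolvent X t)"
    and "(\<And>z. 0 < Re z \<Longrightarrow> f z = z * g z) \<Longrightarrow> mat_fun f X = X ** (LINT t|\<mu>. resolvent X t)"
proof -
  obtain p h where h: "h holomorphic_on {z. 0 < Re z}"
    and eq: "\<And>z. 0 < Re z \<Longrightarrow> g z = poly p z + poly (minpoly X) z * h z"
    and i: "integrable \<mu> (resolvent X)" and p: "mat_poly p X = (LINT t|\<mu>. resolvent X t)"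
    using stieltjes_interpolant[OF sets int g X c] by blast
  have root: "l \<in> {z. 0 < Re z}" if "poly (minpoly X) l = 0" for l
    using accretive_minpoly_root[OF X that] c by simp
  have H: "open {z. 0 < Re z}" by (rule open_halfspace_Re_gt)
  show "integrable \<mu> (resolvent X)" by (rule i)
  show "mat_fun g X = (LINT t|\<mu>. resolvent X t)"
    using mat_fun_eqI[OF H root h, of X g p] eq p by simp
  assume f: "\<And>z. 0 < Re z \<Longrightarrow> f z = z * g z"
  have zh: "(\<lambda>z. z * h z) holomorphic_on {z. 0 < Re z}" by (intro holomorphic_intros h)
  have "mat_fun f X = mat_poly ([:0, 1:] * p) X"
    by (rule mat_fun_eqI[OF H root zh]) (auto simp: f eq algebra_simps)
  then show "mat_fun f X = X ** (LINT t|\<mu>. resolvent X t)"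
    unfolding mat_poly_mult mat_poly_linear p by (simp add: mat_def zero_vec_def[symmetric])
qed
section \<open>The Frechet derivative and the condition number\<close>

text \<open>The resolvent identity in the parameter, \<open>R\<^sub>s - R\<^sub>t = (t - s) R\<^sub>s R\<^sub>t\<close>, gives a Lipschitz bound.\<close>
lemma continuous_on_resolvent:
  fixes X :: "complex ^ 'n ^ 'n"
  assumes X: "accretive c X" and c: "0 < c"
  shows "continuous_on {0..} (resolvent X)"
proof (rule lipschitz_on_continuous_on)
  show "(norm (mat 1 :: complex ^ 'n ^ 'n) / c\<^sup>2)-lipschitz_on {0..} (resolvent X)"
  proof (rule lipschitz_onI)
    fix s t :: real assume "s \<in> {0..}" "t \<in> {0..}"
    then have st: "0 \<le> s" "0 \<le> t" by auto
    have "resolvent X s - resolvent X t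
        = resolvent X s ** ((mat (of_real t) + X) - (mat (of_real s) + X)) ** resolvent X t"
    proof -
      have "resolvent X s ** ((mat (of_real t) + X) - (mat (of_real s) + X)) ** resolvent X t
          = resolvent X s ** ((mat (of_real t) + X) ** resolvent X t)
            - (resolvent X s ** (mat (of_real s) + X)) ** resolvent X t"
        by (simp only: matrix_mult.diff_left matrix_mult.diff_right matrix_mul_assoc)
      then show ?thesis
        using st c by (simp add: resolvent_mult[OF X])
    qed
    also have "(mat (complex_of_real t) + X) - (mat (of_real s) + X) = (t - s) *\<^sub>R mat 1"
      by (simp add: vec_eq_iff mat_def scaleR_conv_of_real[where 'a=complex])
    finally have "norm (resolvent X s - resolvent X t)
        = \<bar>t - s\<bar> * norm (resolvent X s ** (resolvent X t ** mat 1))"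
      by (simp add: matrix_mult.scaleR_left matrix_mult.scaleR_right)
    also have "\<dots> \<le> \<bar>t - s\<bar> * (norm (resolvent X t ** mat 1) / (s + c))"
      using st c by (intro mult_left_mono norm_resolvent_mult_le[OF X]) auto
    also have "\<dots> \<le> \<bar>t - s\<bar> * ((norm (mat 1 :: complex ^ 'n ^ 'n) / (t + c)) / (s + c))"
      using st c by (intro mult_left_mono divide_right_mono norm_resolvent_mult_le[OF X]) auto
    also have "\<dots> \<le> \<bar>t - s\<bar> * ((norm (mat 1 :: complex ^ 'n ^ 'n) / c) / c)"
      using st c by (intro mult_left_mono frac_le) auto
    finally show "dist (resolvent X s) (resolvent X t) \<le> norm (mat 1 :: complex ^ 'n ^ 'n) / c\<^sup>2 * dist s t"
      by (simp add: dist_norm dist_real_def power2_eq_square abs_minus_commute mult.commute)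
  qed simp
qed

text \<open>With a quadratic remainder the difference quotient at radius \<open>\<epsilon>\<close> is within \<open>\<bar>K\<bar> \<epsilon>\<close> of the operator
  norm of \<open>L\<close>: from above directly, from below by scaling every direction to length \<open>\<epsilon>\<close>.\<close>
lemma cond_abs_quot_tendsto_onorm:
  fixes A :: "complex ^ 'n ^ 'n"
  assumes L: "bounded_linear L" and r: "0 < r"
    and rem: "\<And>E. norm E \<le> r \<Longrightarrow> norm (mat_fun f (A + E) - mat_fun f A - L E) \<le> K * (norm E)\<^sup>2"
  shows "(cond_abs_quot f A \<longlongrightarrow> ereal (onorm L)) (at_right 0)"
proof -
  define C where "C = \<bar>K\<bar>"
  have C: "0 \<le> C" by (simp add: C_def)
  have rem: "norm (mat_fun f (A + E) - mat_fun f A - L E) \<le> C * (norm E)\<^sup>2" if "norm E \<le> r" for E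
  proof -
    have "K * (norm E)\<^sup>2 \<le> C * (norm E)\<^sup>2"
      by (rule mult_right_mono) (simp_all add: C_def)
    then show ?thesis using rem[OF that] by linarith
  qed
  have upper: "cond_abs_quot f A \<epsilon> \<le> ereal (onorm L + C * \<epsilon>)" if e: "0 < \<epsilon>" "\<epsilon> < r" for \<epsilon>
    unfolding cond_abs_quot_def
  proof (rule SUP_least)
    fix E :: "complex ^ 'n ^ 'n" assume "E \<in> {E. norm E \<le> \<epsilon>}"
    then have E: "norm E \<le> \<epsilon>" by simp
    have "norm (mat_fun f (A + E) - mat_fun f A)
        \<le> norm (mat_fun f (A + E) - mat_fun f A - L E) + norm (L E)"
      by (metis diff_add_cancel norm_triangle_ineq)
    also have "\<dots> \<le> C * (norm E)\<^sup>2 + onorm L * norm E"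
      using E e by (intro add_mono rem onorm[OF L]) auto
    also have "\<dots> \<le> C * \<epsilon>\<^sup>2 + onorm L * \<epsilon>"
      using E C onorm_pos_le[OF L] by (intro add_mono mult_left_mono power_mono) auto
    finally show "ereal (norm (mat_fun f (A + E) - mat_fun f A) / \<epsilon>) \<le> ereal (onorm L + C * \<epsilon>)"
      using e by (simp add: divide_le_eq algebra_simps power2_eq_square)
  qed
  have lower: "ereal (onorm L - C * \<epsilon>) \<le> cond_abs_quot f A \<epsilon>" if e: "0 < \<epsilon>" "\<epsilon> < r" for \<epsilon>
  proof -
    have sup: "ereal (norm (mat_fun f (A + E) - mat_fun f A) / \<epsilon>) \<le> cond_abs_quot f A \<epsilon>"
      if "norm E \<le> \<epsilon>" for E
      unfolding cond_abs_quot_def using that by (intro SUP_upper) simp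
    have "0 \<le> cond_abs_quot f A \<epsilon>" using sup[of 0] e by (simp flip: zero_ereal_def)
    then obtain q where q: "cond_abs_quot f A \<epsilon> = ereal q" "0 \<le> q"
      using upper[OF e] by (cases "cond_abs_quot f A \<epsilon>") auto
    have "onorm L \<le> q + C * \<epsilon>"
    proof (rule onorm_bound)
      show "0 \<le> q + C * \<epsilon>" using q C e by simp
      fix E :: "complex ^ 'n ^ 'n"
      show "norm (L E) \<le> (q + C * \<epsilon>) * norm E"
      proof (cases "E = 0")
        case True
        then show ?thesis using linear_simps(3)[OF L] by simp
      next
        case False
        define D where "D = (\<epsilon> / norm E) *\<^sub>R E"
        have D: "norm D = \<epsilon>" using False e by (simp add: D_def)
        have "norm (L D) \<le> norm (mat_fun f (A + D) - mat_fun f A)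
            + norm (mat_fun f (A + D) - mat_fun f A - L D)"
          using norm_triangle_ineq4[of "mat_fun f (A + D) - mat_fun f A"
              "mat_fun f (A + D) - mat_fun f A - L D"] by simp
        also have "\<dots> \<le> q * \<epsilon> + C * \<epsilon>\<^sup>2"
          using sup[of D] rem[of D] D e by (simp add: q divide_le_eq)
        finally have "(\<epsilon> / norm E) * norm (L E) \<le> (q + C * \<epsilon>) * \<epsilon>"
          using e by (simp add: D_def linear_simps(5)[OF L] power2_eq_square algebra_simps)
        then have "\<epsilon> * norm (L E) \<le> \<epsilon> * ((q + C * \<epsilon>) * norm E)"
          using False by (simp add: field_simps)
        then show ?thesis using e by (simp only: mult_le_cancel_left_pos)
      qed
    qed
    then show ?thesis using q by simp
  qed
  show ?thesis
  proof (rule tendsto_sandwich)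
    show "\<forall>\<^sub>F \<epsilon> in at_right 0. ereal (onorm L - C * \<epsilon>) \<le> cond_abs_quot f A \<epsilon>"
      using lower r by (auto simp: eventually_at_right_field)
    show "\<forall>\<^sub>F \<epsilon> in at_right 0. cond_abs_quot f A \<epsilon> \<le> ereal (onorm L + C * \<epsilon>)"
      using upper r by (auto simp: eventually_at_right_field)
    show "((\<lambda>\<epsilon>. ereal (onorm L - C * \<epsilon>)) \<longlongrightarrow> ereal (onorm L)) (at_right 0)"
      "((\<lambda>\<epsilon>. ereal (onorm L + C * \<epsilon>)) \<longlongrightarrow> ereal (onorm L)) (at_right 0)"
      by (auto intro!: tendsto_eq_intros)
  qed
qed

lemma abs_onorm_diff_le:
  assumes f: "bounded_linear f" and g: "bounded_linear g"
    and b: "\<And>x. norm (f x - g x) \<le> b * norm x" and "0 \<le> b"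
  shows "\<bar>onorm f - onorm g\<bar> \<le> b"
proof -
  have "onorm f \<le> onorm g + b"
  proof (rule onorm_bound)
    show "norm (f x) \<le> (onorm g + b) * norm x" for x
      using norm_triangle_ineq[of "f x - g x" "g x"] b[of x] onorm[OF g, of x]
      by (simp add: algebra_simps)
  qed (use onorm_pos_le[OF g] assms in auto)
  moreover have "onorm g \<le> onorm f + b"
  proof (rule onorm_bound)
    show "norm (g x) \<le> (onorm f + b) * norm x" for x
      using norm_triangle_ineq[of "g x - f x" "f x"] b[of x] onorm[OF f, of x]
      by (simp add: algebra_simps norm_minus_commute)
  qed (use onorm_pos_le[OF f] assms in auto)
  ultimately show ?thesis by linarith
qed

text \<open>Relations like \<open>X W = l W\<close> and \<open>W X = l W\<close> hold for \<open>W = v v\<^sup>*\<close> when \<open>v\<close> is both a left and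
  a right eigenvector.\<close>
lemma resolvent_mult_eigenmatrix:
  fixes X W :: "complex ^ 'n ^ 'n"
  assumes X: "accretive c X" "0 < t + c"
  shows "X ** W = l *\<^sub>R W \<Longrightarrow> t + l \<noteq> 0 \<Longrightarrow> resolvent X t ** W = (1 / (t + l)) *\<^sub>R W"
    and "W ** X = l *\<^sub>R W \<Longrightarrow> t + l \<noteq> 0 \<Longrightarrow> W ** resolvent X t = (1 / (t + l)) *\<^sub>R W"
proof -
  let ?M = "mat (of_real t) + X"
  assume nz: "t + l \<noteq> 0"
  { assume "X ** W = l *\<^sub>R W"
    then have "?M ** W = (t + l) *\<^sub>R W"
      by (simp add: matrix_mult.add_left mat_of_real_mult scaleR_add_left)
    then have "(t + l) *\<^sub>R (resolvent X t ** W) = (resolvent X t ** ?M) ** W"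
      by (simp add: matrix_mult.scaleR_right flip: matrix_mul_assoc)
    then have "(t + l) *\<^sub>R (resolvent X t ** W) = W"
      by (simp add: resolvent_mult[OF X])
    then show "resolvent X t ** W = (1 / (t + l)) *\<^sub>R W"
      using nz by (metis scaleR_scaleR left_inverse scaleR_one inverse_eq_divide) }
  { assume "W ** X = l *\<^sub>R W"
    then have "W ** ?M = (t + l) *\<^sub>R W"
      by (simp add: matrix_mult.add_right mat_of_real_mult scaleR_add_left flip: mat_mult_commute)
    then have "(t + l) *\<^sub>R (W ** resolvent X t) = W ** (?M ** resolvent X t)"
      by (simp add: matrix_mult.scaleR_left matrix_mul_assoc)
    then have "(t + l) *\<^sub>R (W ** resolvent X t) = W"
      by (simp add: resolvent_mult[OF X])
    then show "W ** resolvent X t = (1 / (t + l)) *\<^sub>R W"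
      using nz by (metis scaleR_scaleR left_inverse scaleR_one inverse_eq_divide) }
qed

definition moment :: "real measure \<Rightarrow> (real \<Rightarrow> real) \<Rightarrow> real \<Rightarrow> nat \<Rightarrow> real" where
  "moment \<mu> w c k = (LINT t|\<mu>. w t / (t + c) ^ k)"

text \<open>Up to sign, the derivative of \<open>X \<mapsto> \<integral> w(t) R\<^sub>t(X) d\<mu>(t)\<close>, which is meaningful even where this
  integral diverges.\<close>
definition frechet ::
  "real measure \<Rightarrow> (real \<Rightarrow> real) \<Rightarrow> complex ^ 'n ^ 'n \<Rightarrow> complex ^ 'n ^ 'n \<Rightarrow> complex ^ 'n ^ 'n" where
  "frechet \<mu> w X E = (LINT t|\<mu>. w t *\<^sub>R (resolvent X t ** E ** resolvent X t))"

text \<open>The common setting of the two classes of functions: \<open>w(t) = 1\<close> for Stieltjes functions and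
  \<open>w(t) = t\<close> for \<open>z\<close> times a Stieltjes function.\<close>
locale weighted_measure =
  fixes \<mu> :: "real measure" and w :: "real \<Rightarrow> real"
  assumes sets: "sets \<mu> = sets (restrict_space borel {0..})"
    and cont: "continuous_on {0..} w"
    and nonneg: "\<And>t. 0 \<le> t \<Longrightarrow> 0 \<le> w t"
    and int: "integrable \<mu> (\<lambda>t. w t / (1 + t)\<^sup>2)"
begin

lemma space_iff: "t \<in> space \<mu> \<longleftrightarrow> 0 \<le> t"
  by (simp add: space_nonneg[OF sets])

lemma integrable_moment:
  assumes c: "0 < c" and k: "2 \<le> k"
  shows "integrable \<mu> (\<lambda>t. w t / (t + c) ^ k)"
proof (rule integrable_if_continuous_dominated[OF sets int])
  show "continuous_on {0..} (\<lambda>t. w t / (t + c) ^ k)"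
    using c by (intro continuous_intros cont) auto
  fix t :: real assume t: "0 \<le> t"
  define d where "d = min 1 c"
  have d: "0 < d" "d \<le> 1" "d \<le> c" using c by (auto simp: d_def)
  have "d * t \<le> t" using d t by (simp add: mult_left_le_one_le)
  then have "(d * (1 + t)) ^ k \<le> (t + c) ^ k"
    using d t by (intro power_mono) (auto simp: algebra_simps)
  moreover have "d ^ k * (1 + t)\<^sup>2 \<le> d ^ k * (1 + t) ^ k"
    using d t k by (intro mult_left_mono power_increasing) auto
  ultimately have "d ^ k * (1 + t)\<^sup>2 \<le> (t + c) ^ k"
    by (simp add: power_mult_distrib)
  then have "w t / (t + c) ^ k \<le> w t / (d ^ k * (1 + t)\<^sup>2)"
    using nonneg[OF t] d t by (intro divide_left_mono mult_pos_pos) auto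
  then show "norm (w t / (t + c) ^ k) \<le> 1 / (min 1 c) ^ k * (w t / (1 + t)\<^sup>2)"
    using nonneg[OF t] c t by (simp add: d_def)
qed

lemma moment_nonneg: "0 < c \<Longrightarrow> 0 \<le> moment \<mu> w c k"
  unfolding moment_def using nonneg
  by (intro integral_nonneg_AE AE_I2) (auto simp: space_iff)

lemma norm_integral_le_moment:
  fixes g :: "real \<Rightarrow> complex ^ 'n ^ 'n"
  assumes g: "continuous_on {0..} g" and b: "\<And>t. 0 \<le> t \<Longrightarrow> norm (g t) \<le> K / (t + c) ^ k"
    and c: "0 < c" and k: "2 \<le> k"
  shows "integrable \<mu> (\<lambda>t. w t *\<^sub>R g t)"
    and "norm (LINT t|\<mu>. w t *\<^sub>R g t) \<le> K * moment \<mu> w c k"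
proof -
  have b': "norm (w t *\<^sub>R g t) \<le> K * (w t / (t + c) ^ k)" if "0 \<le> t" for t
    using mult_left_mono[OF b[OF that] nonneg[OF that]] nonneg[OF that] by (simp add: mult.commute)
  show i: "integrable \<mu> (\<lambda>t. w t *\<^sub>R g t)"
    by (rule integrable_if_continuous_dominated[OF sets integrable_moment[OF c k] _ b'])
       (intro continuous_intros cont g)
  have "norm (LINT t|\<mu>. w t *\<^sub>R g t) \<le> (LINT t|\<mu>. K * (w t / (t + c) ^ k))"
    using i integrable_mult_right[OF integrable_moment[OF c k], of K] b'
    by (intro Bochner_Integration.integral_norm_bound_integral) (auto simp: space_iff)
  then show "norm (LINT t|\<mu>. w t *\<^sub>R g t) \<le> K * moment \<mu> w c k"
    by (simp only: integral_mult_right_zero moment_def)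
qed

lemma norm_sandwich_le:
  fixes X E :: "complex ^ 'n ^ 'n"
  assumes X: "accretive c X" and Y: "accretive c Y" and c: "0 < t + c"
  shows "norm (resolvent X t ** E ** resolvent Y t) \<le> norm E / (t + c)\<^sup>2"
proof -
  have "norm (resolvent X t ** E ** resolvent Y t) \<le> norm (resolvent X t ** E) / (t + c)"
    by (rule norm_resolvent_mult_le(2)[OF Y c])
  also have "\<dots> \<le> norm E / (t + c) / (t + c)"
    using c by (intro divide_right_mono norm_resolvent_mult_le(1)[OF X c]) auto
  finally show ?thesis by (simp add: power2_eq_square)
qed

lemma norm_double_sandwich_le:
  fixes X E Z :: "complex ^ 'n ^ 'n"
  assumes X: "accretive c X" and Y: "accretive c Y" and V: "accretive c V" and c: "0 < t + c"
  shows "norm (resolvent X t ** E ** resolvent Y t ** Z ** resolvent V t)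
    \<le> norm E * norm Z / (t + c) ^ 3"
proof -
  have "norm (resolvent X t ** E ** resolvent Y t ** Z ** resolvent V t)
      \<le> norm (resolvent X t ** E ** resolvent Y t ** Z) / (t + c)"
    by (rule norm_resolvent_mult_le(2)[OF V c])
  also have "\<dots> \<le> (norm (resolvent X t ** E ** resolvent Y t) * norm Z) / (t + c)"
    using c by (intro divide_right_mono norm_matrix_mult_le) auto
  also have "\<dots> \<le> (norm E / (t + c)\<^sup>2 * norm Z) / (t + c)"
    using c by (intro divide_right_mono mult_right_mono norm_sandwich_le X Y) auto
  finally show ?thesis by (simp add: power2_eq_square power3_eq_cube mult_ac)
qed

lemma continuous_on_sandwich:
  assumes "accretive c X" "accretive c Y" "0 < c"
  shows "continuous_on {0..} (\<lambda>t. resolvent X t ** E ** resolvent Y t)"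
  by (intro matrix_mult.continuous_on continuous_on_resolvent assms continuous_on_const)
     (use assms in auto)

lemma integrable_frechet:
  assumes X: "accretive c X" and c: "0 < c"
  shows "integrable \<mu> (\<lambda>t. w t *\<^sub>R (resolvent X t ** E ** resolvent X t))"
    and norm_frechet_le: "norm (frechet \<mu> w X E) \<le> norm E * moment \<mu> w c 2"
proof -
  have "norm (resolvent X t ** E ** resolvent X t) \<le> norm E / (t + c)\<^sup>2" if "0 \<le> t" for t
    using that c by (intro norm_sandwich_le[OF X X]) simp
  note * = norm_integral_le_moment[OF continuous_on_sandwich[OF X X c] this c order_refl]
  show "integrable \<mu> (\<lambda>t. w t *\<^sub>R (resolvent X t ** E ** resolvent X t))" by (rule *(1))
  show "norm (frechet \<mu> w X E) \<le> norm E * moment \<mu> w c 2"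
    unfolding frechet_def by (rule *(2))
qed

lemma bounded_linear_frechet:
  assumes X: "accretive c X" and c: "0 < c"
  shows "bounded_linear (frechet \<mu> w X)"
proof (rule bounded_linear_intro)
  note i = integrable_frechet(1)[OF X c]
  show "frechet \<mu> w X (E + D) = frechet \<mu> w X E + frechet \<mu> w X D" for E D
    unfolding frechet_def by (subst Bochner_Integration.integral_add[OF i i, symmetric])
       (simp add: matrix_mult.add_left matrix_mult.add_right scaleR_add_right)
  show "frechet \<mu> w X (r *\<^sub>R E) = r *\<^sub>R frechet \<mu> w X E" for r E
    unfolding frechet_def
    by (subst integral_scaleR_right[symmetric])
       (simp add: matrix_mult.scaleR_left matrix_mult.scaleR_right mult.commute)
  show "norm (frechet \<mu> w X E) \<le> norm E * moment \<mu> w c 2" for E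
    by (rule norm_frechet_le[OF X c])
qed

text \<open>With \<open>S = R\<^sub>t(X + Z)\<close> and \<open>R = R\<^sub>t(X)\<close> the integrand is \<open>(S - R) E S + R E (S - R)\<close>, and
  \<open>S - R = - S Z R\<close>. Each of the two terms contains three resolvents and one factor \<open>Z\<close>, hence the third
  moment and the factor two.\<close>
lemma norm_frechet_diff_le:
  assumes X: "accretive c X" and Z: "norm Z \<le> \<epsilon>" and e: "\<epsilon> < c"
  shows "norm (frechet \<mu> w (X + Z) E - frechet \<mu> w X E) \<le> 2 * \<epsilon> * moment \<mu> w (c - \<epsilon>) 3 * norm E"
proof -
  define d where "d = c - \<epsilon>"
  have e0: "0 \<le> \<epsilon>" using Z norm_ge_zero order_trans by blast
  have d: "0 < d" "d \<le> c" using e e0 by (auto simp: d_def)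
  have X': "accretive d X" by (rule accretive_mono[OF X d(2)])
  have Y: "accretive d (X + Z)"
    by (rule accretive_mono[OF accretive_perturb[OF X]]) (use Z in \<open>simp add: d_def\<close>)
  let ?R = "resolvent X" and ?S = "resolvent (X + Z)"
  have diff: "?S t - ?R t = - (?S t ** Z ** ?R t)" if "0 \<le> t" for t
    using resolvent_diff[OF X' _ Y, of t] that d
    by (simp add: matrix_mult.minus_left matrix_mult.minus_right)
  define g where "g t = ?S t ** E ** ?S t - ?R t ** E ** ?R t" for t
  have "frechet \<mu> w (X + Z) E - frechet \<mu> w X E = (LINT t|\<mu>. w t *\<^sub>R g t)"
    unfolding frechet_def g_def
    by (subst Bochner_Integration.integral_diff[OF integrable_frechet(1)[OF Y d(1)]
          integrable_frechet(1)[OF X' d(1)], symmetric]) (simp add: scaleR_diff_right)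
  moreover have "norm (LINT t|\<mu>. w t *\<^sub>R g t) \<le> (2 * \<epsilon> * norm E) * moment \<mu> w d 3"
  proof (rule norm_integral_le_moment(2))
    show "continuous_on {0..} g"
      unfolding g_def using d by (intro continuous_intros continuous_on_sandwich[OF X' X']
          continuous_on_sandwich[OF Y Y]) auto
    fix t :: real assume t: "0 \<le> t"
    have "g t = (?S t - ?R t) ** E ** ?S t + ?R t ** E ** (?S t - ?R t)"
      by (simp add: g_def matrix_mult.diff_left matrix_mult.diff_right)
    also have "\<dots> = - (?S t ** Z ** ?R t ** E ** ?S t) - ?R t ** E ** ?S t ** Z ** ?R t"
      unfolding diff[OF t]
      by (simp add: matrix_mult.minus_left matrix_mult.minus_right matrix_mul_assoc)
    finally have "norm (g t) \<le> norm (?S t ** Z ** ?R t ** E ** ?S t) + norm (?R t ** E ** ?S t ** Z ** ?R t)"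
      by (metis norm_minus_cancel norm_triangle_ineq4)
    also have "\<dots> \<le> norm Z * norm E / (t + d) ^ 3 + norm E * norm Z / (t + d) ^ 3"
      using t d by (intro add_mono norm_double_sandwich_le X' Y) auto
    also have "\<dots> = 2 * norm Z * norm E / (t + d) ^ 3" by simp
    also have "\<dots> \<le> 2 * \<epsilon> * norm E / (t + d) ^ 3"
      using t d Z by (intro divide_right_mono mult_right_mono) auto
    finally show "norm (g t) \<le> 2 * \<epsilon> * norm E / (t + d) ^ 3" .
  qed (use d in auto)
  ultimately show ?thesis by (simp add: d_def mult_ac)
qed

text \<open>Using \<open>S - R = - S E R\<close> twice, \<open>S - R + R E R = S E R E R\<close>.\<close>
lemma norm_frechet_remainder_le:
  assumes X: "accretive c X" and E: "norm E \<le> c / 2" and c: "0 < c"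
  shows "norm ((LINT t|\<mu>. w t *\<^sub>R (resolvent (X + E) t - resolvent X t)) + frechet \<mu> w X E)
    \<le> moment \<mu> w (c / 2) 3 * (norm E)\<^sup>2"
proof -
  define d where "d = c / 2"
  have d: "0 < d" "d \<le> c" using c by (auto simp: d_def)
  have X': "accretive d X" by (rule accretive_mono[OF X d(2)])
  have Y: "accretive d (X + E)"
    by (rule accretive_mono[OF accretive_perturb[OF X]]) (use E in \<open>simp add: d_def\<close>)
  let ?R = "resolvent X" and ?S = "resolvent (X + E)"
  have diff: "?S t - ?R t = - (?S t ** E ** ?R t)" if "0 \<le> t" for t
    using resolvent_diff[OF X' _ Y, of t] that d
    by (simp add: matrix_mult.minus_left matrix_mult.minus_right)
  have i: "integrable \<mu> (\<lambda>t. w t *\<^sub>R (?S t - ?R t))"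
  proof (rule norm_integral_le_moment(1))
    show "continuous_on {0..} (\<lambda>t. ?S t - ?R t)"
      by (intro continuous_intros continuous_on_resolvent[OF X' d(1)] continuous_on_resolvent[OF Y d(1)])
    show "norm (?S t - ?R t) \<le> norm E / (t + d) ^ 2" if "0 \<le> t" for t
      using norm_sandwich_le[OF Y X', of t E] that d by (simp add: diff)
  qed (use d in auto)
  have "(LINT t|\<mu>. w t *\<^sub>R (?S t - ?R t)) + frechet \<mu> w X E
      = (LINT t|\<mu>. w t *\<^sub>R (?S t - ?R t + ?R t ** E ** ?R t))"
    unfolding frechet_def
    by (subst Bochner_Integration.integral_add[OF i integrable_frechet(1)[OF X c], symmetric])
       (simp add: scaleR_add_right)
  also have "norm \<dots> \<le> (norm E * norm E) * moment \<mu> w d 3"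
  proof (rule norm_integral_le_moment(2))
    show "continuous_on {0..} (\<lambda>t. ?S t - ?R t + ?R t ** E ** ?R t)"
      by (intro continuous_intros continuous_on_sandwich[OF X' X' d(1)]
          continuous_on_resolvent[OF X' d(1)] continuous_on_resolvent[OF Y d(1)])
    fix t :: real assume t: "0 \<le> t"
    have "?S t - ?R t + ?R t ** E ** ?R t = - (?S t ** E ** ?R t) + ?R t ** E ** ?R t"
      by (simp only: diff[OF t])
    also have "\<dots> = - ((?S t - ?R t) ** E ** ?R t)"
      by (simp add: matrix_mult.diff_left)
    also have "\<dots> = ?S t ** E ** ?R t ** E ** ?R t"
      unfolding diff[OF t] by (simp add: matrix_mult.minus_left)
    finally have "norm (?S t - ?R t + ?R t ** E ** ?R t) = norm (?S t ** E ** ?R t ** E ** ?R t)"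
      by simp
    also have "\<dots> \<le> norm E * norm E / (t + d) ^ 3"
      using t d by (intro norm_double_sandwich_le X' Y) auto
    finally show "norm (?S t - ?R t + ?R t ** E ** ?R t) \<le> norm E * norm E / (t + d) ^ 3" .
  qed (use d in auto)
  finally show ?thesis by (simp add: d_def power2_eq_square mult_ac)
qed

lemma frechet_eigenmatrix:
  fixes X W :: "complex ^ 'n ^ 'n"
  assumes X: "accretive c X" "0 < c" and W: "X ** W = l *\<^sub>R W" "W ** X = l *\<^sub>R W" and l: "0 < l"
  shows "frechet \<mu> w X W = moment \<mu> w l 2 *\<^sub>R W"
proof -
  have "frechet \<mu> w X W = (LINT t|\<mu>. (w t / (t + l)\<^sup>2) *\<^sub>R W)"
    unfolding frechet_def
  proof (rule Bochner_Integration.integral_cong[OF refl])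
    fix t assume "t \<in> space \<mu>"
    then have t: "0 \<le> t" by (simp add: space_iff)
    have "resolvent X t ** W = (1 / (t + l)) *\<^sub>R W" "W ** resolvent X t = (1 / (t + l)) *\<^sub>R W"
      using resolvent_mult_eigenmatrix[OF X(1), of t] W X(2) l t by auto
    then show "w t *\<^sub>R (resolvent X t ** W ** resolvent X t) = (w t / (t + l)\<^sup>2) *\<^sub>R W"
      by (simp add: matrix_mult.scaleR_left power2_eq_square)
  qed
  also have "\<dots> = moment \<mu> w l 2 *\<^sub>R W"
    unfolding moment_def using integrable_moment[OF l, of 2] by (intro integral_scaleR_left) auto
  finally show ?thesis .
qed

text \<open>Pointwise this is the tangent inequality of the convex function \<open>1 / x\<^sup>2\<close> at \<open>x = t + l\<close>.\<close>
lemma moment_two_diff_ge: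
  assumes "0 < \<epsilon>" "\<epsilon> < l"
  shows "2 * \<epsilon> * moment \<mu> w l 3 \<le> moment \<mu> w (l - \<epsilon>) 2 - moment \<mu> w l 2"
proof -
  have i: "integrable \<mu> (\<lambda>t. w t / (t + (l - \<epsilon>))\<^sup>2)" "integrable \<mu> (\<lambda>t. w t / (t + l)\<^sup>2)"
    "integrable \<mu> (\<lambda>t. w t / (t + l) ^ 3)"
    using assms by (auto intro!: integrable_moment)
  have "2 * \<epsilon> * moment \<mu> w l 3 = (LINT t|\<mu>. 2 * \<epsilon> * (w t / (t + l) ^ 3))"
    by (simp only: moment_def integral_mult_right_zero)
  also have "\<dots> \<le> (LINT t|\<mu>. w t / (t + (l - \<epsilon>))\<^sup>2 - w t / (t + l)\<^sup>2)"
  proof (rule integral_mono)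
    show "integrable \<mu> (\<lambda>t. 2 * \<epsilon> * (w t / (t + l) ^ 3))" by (rule integrable_mult_right[OF i(3)])
    show "integrable \<mu> (\<lambda>t. w t / (t + (l - \<epsilon>))\<^sup>2 - w t / (t + l)\<^sup>2)"
      by (rule Bochner_Integration.integrable_diff[OF i(1,2)])
    fix t assume "t \<in> space \<mu>"
    then have t: "0 \<le> t" by (simp add: space_iff)
    define x where "x = t + l"
    have x: "0 < x - \<epsilon>" "0 < x" using t assms by (auto simp: x_def)
    \<comment> \<open>This product is \<open>x\<^sup>3 - (x + 2 \<epsilon>) (x - \<epsilon>)\<^sup>2\<close>.\<close>
    have "0 \<le> \<epsilon> * \<epsilon> * (x + 2 * (x - \<epsilon>))" using x assms by simp
    then have "2 * \<epsilon> * (x - \<epsilon>)\<^sup>2 + x * (x - \<epsilon>)\<^sup>2 \<le> x ^ 3"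
      by (simp add: power2_eq_square power3_eq_cube algebra_simps)
    then have "(2 * \<epsilon> * (x - \<epsilon>)\<^sup>2 + x * (x - \<epsilon>)\<^sup>2) / (x ^ 3 * (x - \<epsilon>)\<^sup>2)
        \<le> x ^ 3 / (x ^ 3 * (x - \<epsilon>)\<^sup>2)"
      using x by (intro divide_right_mono) auto
    moreover have "(2 * \<epsilon> * (x - \<epsilon>)\<^sup>2 + x * (x - \<epsilon>)\<^sup>2) / (x ^ 3 * (x - \<epsilon>)\<^sup>2)
        = 2 * \<epsilon> * (1 / x ^ 3) + 1 / x\<^sup>2"
      using x by (simp add: add_divide_distrib power3_eq_cube power2_eq_square)
    ultimately have "2 * \<epsilon> * (1 / x ^ 3) \<le> 1 / (x - \<epsilon>)\<^sup>2 - 1 / x\<^sup>2"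
      using x by simp
    from mult_left_mono[OF this nonneg[OF t]]
    show "2 * \<epsilon> * (w t / (t + l) ^ 3) \<le> w t / (t + (l - \<epsilon>))\<^sup>2 - w t / (t + l)\<^sup>2"
      by (simp add: x_def algebra_simps)
  qed
  also have "\<dots> = moment \<mu> w (l - \<epsilon>) 2 - moment \<mu> w l 2"
    unfolding moment_def by (rule Bochner_Integration.integral_diff[OF i(1,2)])
  finally show ?thesis .
qed

text \<open>Since \<open>t + l - \<epsilon> \<ge> (1 - \<epsilon> / l) (t + l)\<close> for \<open>t \<ge> 0\<close>. This gives the limit \<open>\<epsilon> \<rightarrow> 0\<close> without
  a convergence theorem for the integrals.\<close>
lemma moment_shift_le:
  assumes "0 < \<epsilon>" "\<epsilon> < l"
  shows "moment \<mu> w (l - \<epsilon>) 3 \<le> moment \<mu> w l 3 / (1 - \<epsilon> / l) ^ 3"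
proof -
  have "moment \<mu> w (l - \<epsilon>) 3 \<le> (LINT t|\<mu>. 1 / (1 - \<epsilon> / l) ^ 3 * (w t / (t + l) ^ 3))"
    unfolding moment_def
  proof (rule integral_mono)
    show "integrable \<mu> (\<lambda>t. w t / (t + (l - \<epsilon>)) ^ 3)"
      using assms by (intro integrable_moment) auto
    have "integrable \<mu> (\<lambda>t. w t / (t + l) ^ 3)"
      using assms by (intro integrable_moment) auto
    then show "integrable \<mu> (\<lambda>t. 1 / (1 - \<epsilon> / l) ^ 3 * (w t / (t + l) ^ 3))"
      by (rule integrable_mult_right)
    fix t assume "t \<in> space \<mu>"
    then have t: "0 \<le> t" by (simp add: space_iff)
    have q: "0 < 1 - \<epsilon> / l" using assms by simp
    have "(1 - \<epsilon> / l) * (t + l) \<le> t + (l - \<epsilon>)"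
      using assms t by (simp add: field_simps)
    then have "((1 - \<epsilon> / l) * (t + l)) ^ 3 \<le> (t + (l - \<epsilon>)) ^ 3"
      using q t assms by (intro power_mono) auto
    then have "w t / (t + (l - \<epsilon>)) ^ 3 \<le> w t / ((1 - \<epsilon> / l) * (t + l)) ^ 3"
      using q t assms nonneg[OF t] by (intro divide_left_mono mult_pos_pos) auto
    then show "w t / (t + (l - \<epsilon>)) ^ 3 \<le> 1 / (1 - \<epsilon> / l) ^ 3 * (w t / (t + l) ^ 3)"
      by (simp add: power_mult_distrib)
  qed
  then show ?thesis by (simp only: integral_mult_right_zero moment_def) simp
qed

text \<open>Here \<open>f\<close> enters only through its integral representation up to a constant, so that both
  classes of functions are covered. The sign \<open>s\<close> disappears in the norm.\<close>
lemma cond_abs_quot_tendsto: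
  fixes f :: "complex \<Rightarrow> complex" and X :: "complex ^ 'n ^ 'n"
  assumes rep: "\<And>c X Y :: complex ^ 'n ^ 'n. 0 < c \<Longrightarrow> accretive c X \<Longrightarrow> accretive c Y \<Longrightarrow>
      mat_fun f Y - mat_fun f X = s *\<^sub>R (LINT t|\<mu>. w t *\<^sub>R (resolvent Y t - resolvent X t))"
    and s: "\<bar>s\<bar> = 1" and X: "accretive c X" and c: "0 < c"
  shows "(cond_abs_quot f X \<longlongrightarrow> ereal (onorm (frechet \<mu> w X))) (at_right 0)"
proof -
  have "(cond_abs_quot f X \<longlongrightarrow> ereal (onorm (\<lambda>E. (- s) *\<^sub>R frechet \<mu> w X E))) (at_right 0)"
  proof (rule cond_abs_quot_tendsto_onorm)
    show "bounded_linear (\<lambda>E. (- s) *\<^sub>R frechet \<mu> w X E)"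
      by (rule bounded_linear_const_scaleR[OF bounded_linear_frechet[OF X c]])
    show "0 < c / 2" using c by simp
    fix E :: "complex ^ 'n ^ 'n" assume E: "norm E \<le> c / 2"
    have "accretive (c / 2) X" by (rule accretive_mono[OF X]) (use c in simp)
    moreover have "accretive (c / 2) (X + E)"
      by (rule accretive_mono[OF accretive_perturb[OF X]]) (use E in simp)
    ultimately have "mat_fun f (X + E) - mat_fun f X
        = s *\<^sub>R (LINT t|\<mu>. w t *\<^sub>R (resolvent (X + E) t - resolvent X t))"
      using c by (intro rep[of "c / 2"]) auto
    then have "mat_fun f (X + E) - mat_fun f X - (- s) *\<^sub>R frechet \<mu> w X E
        = s *\<^sub>R ((LINT t|\<mu>. w t *\<^sub>R (resolvent (X + E) t - resolvent X t)) + frechet \<mu> w X E)"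
      by (simp add: scaleR_add_right)
    then have "norm (mat_fun f (X + E) - mat_fun f X - (- s) *\<^sub>R frechet \<mu> w X E)
        = norm ((LINT t|\<mu>. w t *\<^sub>R (resolvent (X + E) t - resolvent X t)) + frechet \<mu> w X E)"
      using s by simp
    then show "norm (mat_fun f (X + E) - mat_fun f X - (- s) *\<^sub>R frechet \<mu> w X E)
        \<le> moment \<mu> w (c / 2) 3 * (norm E)\<^sup>2"
      using norm_frechet_remainder_le[OF X E c] by simp
  qed
  moreover have "onorm (\<lambda>E. (- s) *\<^sub>R frechet \<mu> w X E) = onorm (frechet \<mu> w X)"
    unfolding onorm_scaleR[OF bounded_linear_frechet[OF X c]] using s by simp
  ultimately show ?thesis by (simp only:)
qed

text \<open>The quotient at radius \<open>\<epsilon>\<close> lies between \<open>2 m\<^sub>3(l)\<close> and \<open>2 m\<^sub>3(l) / (1 - \<epsilon> / l)\<^sup>3\<close>. The lower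
  bound comes from the single perturbation \<open>- \<epsilon> W\<close>, which moves the eigenvalue \<open>l\<close> to \<open>l - \<epsilon>\<close> and
  keeps \<open>W\<close> as a test direction for the derivative.\<close>
theorem cond_abs2_eq_moment:
  fixes f :: "complex \<Rightarrow> complex" and A W :: "complex ^ 'n ^ 'n"
  assumes rep: "\<And>c X Y :: complex ^ 'n ^ 'n. 0 < c \<Longrightarrow> accretive c X \<Longrightarrow> accretive c Y \<Longrightarrow>
      mat_fun f Y - mat_fun f X = s *\<^sub>R (LINT t|\<mu>. w t *\<^sub>R (resolvent Y t - resolvent X t))"
    and s: "\<bar>s\<bar> = 1" and A: "accretive l A" and l: "0 < l"
    and W: "A ** W = l *\<^sub>R W" "W ** A = l *\<^sub>R W" "W ** W = W" "norm W = 1"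
  shows "cond_abs2_exists f A \<and> cond_abs2 f A = ereal (2 * moment \<mu> w l 3)"
proof -
  define N where "N Z = onorm (frechet \<mu> w (A + Z))" for Z
  have acc: "accretive (l - norm Z) (A + Z)" for Z by (rule accretive_perturb[OF A])
  have lim: "(cond_abs_quot f (A + Z) \<longlongrightarrow> ereal (N Z)) (at_right 0)" if "norm Z < l" for Z
    unfolding N_def using that by (intro cond_abs_quot_tendsto[OF rep s acc]) auto
  then have cond: "cond_abs f (A + Z) = ereal (N Z)" if "norm Z < l" for Z
    unfolding cond_abs_def using that by (intro tendsto_Lim) auto
  have cond0: "cond_abs f A = ereal (N 0)" using cond[of 0] l by simp
  have bl: "bounded_linear (frechet \<mu> w (A + Z))" if "norm Z < l" for Z
    using that by (intro bounded_linear_frechet[OF acc]) auto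
  have upper: "cond_abs2_quot f A \<epsilon> \<le> ereal (2 * moment \<mu> w l 3 / (1 - \<epsilon> / l) ^ 3)"
    if e: "0 < \<epsilon>" "\<epsilon> < l" for \<epsilon>
    unfolding cond_abs2_quot_def
  proof (rule SUP_least)
    fix Z :: "complex ^ 'n ^ 'n" assume "Z \<in> {Z. norm Z \<le> \<epsilon>}"
    then have Z: "norm Z \<le> \<epsilon>" "norm Z < l" using e by auto
    have "\<bar>N Z - N 0\<bar> \<le> 2 * \<epsilon> * moment \<mu> w (l - \<epsilon>) 3"
      unfolding N_def
    proof (rule abs_onorm_diff_le[OF bl[OF Z(2)]])
      show "bounded_linear (frechet \<mu> w (A + 0))" using bl[of 0] l by simp
      show "norm (frechet \<mu> w (A + Z) E - frechet \<mu> w (A + 0) E)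
          \<le> 2 * \<epsilon> * moment \<mu> w (l - \<epsilon>) 3 * norm E" for E
        using norm_frechet_diff_le[OF A Z(1) e(2)] by simp
      show "0 \<le> 2 * \<epsilon> * moment \<mu> w (l - \<epsilon>) 3"
        using e moment_nonneg[of "l - \<epsilon>" 3] by simp
    qed
    also have "\<dots> \<le> 2 * \<epsilon> * (moment \<mu> w l 3 / (1 - \<epsilon> / l) ^ 3)"
      using e by (intro mult_left_mono moment_shift_le) auto
    finally have "\<bar>N Z - N 0\<bar> / \<epsilon> \<le> 2 * moment \<mu> w l 3 / (1 - \<epsilon> / l) ^ 3"
      using e by (simp add: pos_divide_le_eq mult_ac)
    then show "\<bar>cond_abs f (A + Z) - cond_abs f A\<bar> / ereal \<epsilon>
        \<le> ereal (2 * moment \<mu> w l 3 / (1 - \<epsilon> / l) ^ 3)"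
      using e by (simp add: cond[OF Z(2)] cond0)
  qed
  have lower: "ereal (2 * moment \<mu> w l 3) \<le> cond_abs2_quot f A \<epsilon>" if e: "0 < \<epsilon>" "\<epsilon> < l" for \<epsilon>
  proof -
    define Z where "Z = - (\<epsilon> *\<^sub>R W)"
    have Z: "norm Z = \<epsilon>" "norm Z < l" using e W(4) by (simp_all add: Z_def)
    have eig: "(A + Z) ** W = (l - \<epsilon>) *\<^sub>R W" "W ** (A + Z) = (l - \<epsilon>) *\<^sub>R W"
      by (simp_all add: Z_def matrix_mult.diff_left matrix_mult.diff_right matrix_mult.scaleR_left
          matrix_mult.scaleR_right W scaleR_diff_left)
    have "accretive (l - \<epsilon>) (A + Z)" using acc[of Z] Z by simp
    from frechet_eigenmatrix[OF this _ eig] e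
    have "frechet \<mu> w (A + Z) W = moment \<mu> w (l - \<epsilon>) 2 *\<^sub>R W" by simp
    then have "moment \<mu> w (l - \<epsilon>) 2 \<le> N Z"
      using onorm[OF bl[OF Z(2)], of W] W(4) by (simp add: N_def)
    moreover have "N 0 \<le> moment \<mu> w l 2"
      unfolding N_def using norm_frechet_le[OF A l] moment_nonneg[OF l]
      by (intro onorm_bound) (auto simp: mult.commute)
    ultimately have "2 * \<epsilon> * moment \<mu> w l 3 \<le> \<bar>N Z - N 0\<bar>"
      using moment_two_diff_ge[OF e] by linarith
    then have "ereal (2 * moment \<mu> w l 3) \<le> \<bar>cond_abs f (A + Z) - cond_abs f A\<bar> / ereal \<epsilon>"
      using e by (simp add: cond[OF Z(2)] cond0 pos_le_divide_eq mult_ac)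
    also have "\<dots> \<le> cond_abs2_quot f A \<epsilon>"
      unfolding cond_abs2_quot_def using Z by (intro SUP_upper) simp
    finally show ?thesis .
  qed
  have "(cond_abs2_quot f A \<longlongrightarrow> ereal (2 * moment \<mu> w l 3)) (at_right 0)"
  proof (rule tendsto_sandwich)
    show "\<forall>\<^sub>F \<epsilon> in at_right 0. ereal (2 * moment \<mu> w l 3) \<le> cond_abs2_quot f A \<epsilon>"
      using lower l by (auto simp: eventually_at_right_field)
    show "\<forall>\<^sub>F \<epsilon> in at_right 0. cond_abs2_quot f A \<epsilon> \<le> ereal (2 * moment \<mu> w l 3 / (1 - \<epsilon> / l) ^ 3)"
      using upper l by (auto simp: eventually_at_right_field)
    have "((\<lambda>\<epsilon>. 2 * moment \<mu> w l 3 / (1 - \<epsilon> / l) ^ 3) \<longlongrightarrow> 2 * moment \<mu> w l 3 / (1 - 0 / l) ^ 3) (at_right 0)"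
      by (intro tendsto_intros) (use l in auto)
    then show "((\<lambda>\<epsilon>. ereal (2 * moment \<mu> w l 3 / (1 - \<epsilon> / l) ^ 3)) \<longlongrightarrow> ereal (2 * moment \<mu> w l 3)) (at_right 0)"
      by simp
  qed simp
  moreover have "\<forall>\<^sub>F Z in nhds (0 :: complex ^ 'n ^ 'n). norm Z < l"
    using l eventually_nhds_ball[of l "0 :: complex ^ 'n ^ 'n"] by (simp add: dist_norm)
  then have "\<forall>\<^sub>F Z in nhds 0. \<exists>c. (cond_abs_quot f (A + Z) \<longlongrightarrow> c) (at_right 0)"
    by eventually_elim (use lim in blast)
  ultimately show ?thesis
    unfolding cond_abs2_exists_def cond_abs2_def by (auto intro: tendsto_Lim)
qed

end

section \<open>The level-2 condition number\<close>

lemma (in weighted_measure) cmod_deriv2_eq_moment: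
  fixes f :: "complex \<Rightarrow> complex"
  assumes f: "\<And>z. 0 < Re z \<Longrightarrow> f z = f 1 +
      s * (LINT t|\<mu>. complex_of_real (w t) * (1 / (complex_of_real t + z) - 1 / (complex_of_real t + 1)))"
    and s: "cmod s = 1" and l: "0 < l"
  shows "cmod ((deriv ^^ 2) f (complex_of_real l)) = 2 * moment \<mu> w l 3"
proof -
  let ?H = "{z. 0 < Re z}"
  have H: "open ?H" by (rule open_halfspace_Re_gt)
  have cw: "continuous_on {0..} (\<lambda>t. complex_of_real (w t))"
    by (intro continuous_intros cont)
  have iw: "integrable \<mu> (\<lambda>t. cmod (complex_of_real (w t)) / (1 + t)\<^sup>2)"
    by (subst Bochner_Integration.integrable_cong[OF refl, where g = "\<lambda>t. w t / (1 + t)\<^sup>2"])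
       (auto simp: space_iff nonneg int)
  let ?F = "\<lambda>z. LINT t|\<mu>. complex_of_real (w t) * (1 / (complex_of_real t + z) - 1 / (complex_of_real t + 1))"
  let ?G = "\<lambda>z. LINT t|\<mu>. complex_of_real (w t) / (complex_of_real t + z)\<^sup>2"
  have d1: "deriv f z = - s * ?G z" if z: "0 < Re z" for z
  proof -
    have "((\<lambda>z. f 1 + s * ?F z) has_field_derivative 0 + s * - ?G z) (at z)"
      by (rule DERIV_add[OF DERIV_const DERIV_cmult[OF deriv_stieltjes_transform[OF sets cw iw z]]]) simp
    then have "(f has_field_derivative 0 + s * - ?G z) (at z)"
    proof (rule has_field_derivative_transform_within_open[OF _ H])
      show "f 1 + s * ?F z = f z" if "z \<in> ?H" for z
        using f[of z] that by (simp only: mem_Collect_eq)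
    qed (use z in simp)
    then show ?thesis by (simp add: DERIV_imp_deriv)
  qed
  have l': "0 < Re (complex_of_real l)" using l by simp
  have "((\<lambda>z. - s * ?G z) has_field_derivative
      - s * (- 2 * (LINT t|\<mu>. complex_of_real (w t) / (complex_of_real t + complex_of_real l) ^ 3)))
      (at (complex_of_real l))"
    by (rule DERIV_cmult[OF deriv2_stieltjes_transform[OF sets cw iw l']])
  then have "(deriv f has_field_derivative
      - s * (- 2 * (LINT t|\<mu>. complex_of_real (w t) / (complex_of_real t + complex_of_real l) ^ 3)))
      (at (complex_of_real l))"
    by (rule has_field_derivative_transform_within_open[OF _ H]) (use l' d1 in auto)
  then have "(deriv ^^ 2) f (complex_of_real l) =
      - s * (- 2 * (LINT t|\<mu>. complex_of_real (w t) / (complex_of_real t + complex_of_real l) ^ 3))"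
    by (simp add: numeral_2_eq_2 DERIV_imp_deriv)
  also have "(LINT t|\<mu>. complex_of_real (w t) / (complex_of_real t + complex_of_real l) ^ 3)
      = complex_of_real (moment \<mu> w l 3)"
    unfolding moment_def by (subst integral_complex_of_real[symmetric]) simp
  finally show ?thesis
    using s moment_nonneg[OF l, of 3] by (simp add: norm_mult)
qed

lemma hermitian_inner_commute:
  assumes "hermitian A"
  shows "x \<bullet> (A *v y) = y \<bullet> (A *v x)"
proof -
  have "x \<bullet> (A *v y) = Re (cnj (\<Sum>i\<in>UNIV. \<Sum>j\<in>UNIV. cnj (x $ i) * (A $ i $ j * y $ j)))"
    by (simp only: complex_cnj_cnj cnj.sel inner_eq_Re_form matrix_vector_mult_def vec_lambda_beta sum_distrib_left)
  also have "\<dots> = Re (\<Sum>i\<in>UNIV. \<Sum>j\<in>UNIV. cnj (y $ j) * (A $ j $ i * x $ i))"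
  proof -
    have "cnj (A $ i $ j) = A $ j $ i" for i j
      using assms[unfolded hermitian_def, rule_format, of j i] by (rule sym)
    then show ?thesis by (simp only: cnj_sum complex_cnj_mult complex_cnj_cnj mult_ac)
  qed
  also have "\<dots> = y \<bullet> (A *v x)"
    by (subst sum.swap) (simp only: inner_eq_Re_form matrix_vector_mult_def vec_lambda_beta sum_distrib_left)
  finally show ?thesis .
qed

text \<open>The quadratic form attains its minimum \<open>m\<close> on the unit sphere at some \<open>x\<^sub>0\<close>. The form of \<open>A - m\<close> is
  positive semidefinite and vanishes at \<open>x\<^sub>0\<close>; its first variation there in the direction
  \<open>u = (A - m) x\<^sub>0\<close> must vanish, so \<open>u = 0\<close>. Hence \<open>m\<close> is an eigenvalue and \<open>l \<le> m\<close>.\<close>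
lemma hermitian_accretive_smallest_eigenvalue:
  fixes A :: "complex ^ 'n ^ 'n"
  assumes A: "hermitian A" and l: "smallest_eigenvalue A l"
  shows "accretive l A"
proof -
  define q where "q x = x \<bullet> (A *v x)" for x :: "complex ^ 'n"
  have "continuous_on (sphere 0 1) q"
    unfolding q_def by (intro continuous_intros)
  moreover have "axis undefined 1 \<in> (sphere 0 1 :: (complex ^ 'n) set)" by simp
  ultimately obtain x0 where x0: "norm x0 = 1" "\<And>x. norm x = 1 \<Longrightarrow> q x0 \<le> q x"
    using continuous_attains_inf[of "sphere 0 1" q] by auto
  define m where "m = q x0"
  have min: "m * (norm x)\<^sup>2 \<le> q x" for x
  proof (cases "x = 0")
    case False
    then have "m \<le> q ((1 / norm x) *\<^sub>R x)" unfolding m_def by (intro x0(2)) simp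
    also have "\<dots> = q x / (norm x)\<^sup>2"
      by (simp add: q_def linear_simps(5)[OF matrix_vector_mul_bounded_linear] power2_eq_square)
    finally show ?thesis using False by (simp add: pos_le_divide_eq)
  qed (simp add: q_def)
  define u where "u = A *v x0 - m *\<^sub>R x0"
  define b where "b = q u - m * (norm u)\<^sup>2"
  have b: "0 \<le> b" using min[of u] by (simp add: b_def)
  have quad: "0 \<le> 2 * s * (u \<bullet> u) + s\<^sup>2 * b" for s
  proof -
    have "q (x0 + s *\<^sub>R u) - m * (norm (x0 + s *\<^sub>R u))\<^sup>2
        = (q x0 - m * (norm x0)\<^sup>2) + 2 * s * (u \<bullet> (A *v x0) - m * (u \<bullet> x0)) + s\<^sup>2 * b"
      unfolding q_def b_def power2_norm_eq_inner
      using hermitian_inner_commute[OF A, of x0 u]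
      by (simp add: matrix_vector_right_distrib inner_add_left
          inner_add_right linear_simps(5)[OF matrix_vector_mul_bounded_linear] inner_commute[of x0 u] algebra_simps power2_eq_square)
    also have "q x0 - m * (norm x0)\<^sup>2 = 0" by (simp add: x0(1) m_def)
    also have "u \<bullet> (A *v x0) - m * (u \<bullet> x0) = u \<bullet> u"
      by (simp add: u_def inner_diff_right)
    finally show ?thesis using min[of "x0 + s *\<^sub>R u"] by simp
  qed
  have "u \<bullet> u = 0"
  proof (rule ccontr)
    assume "u \<bullet> u \<noteq> 0"
    define a where "a = u \<bullet> u"
    have a: "0 < a" using \<open>u \<bullet> u \<noteq> 0\<close> by (simp add: a_def)
    \<comment> \<open>At \<open>s = - a / b\<close> the quadratic is minimal; \<open>b + 1\<close> avoids the case \<open>b = 0\<close>.\<close>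
    have "0 \<le> 2 * (- a / (b + 1)) * a + (- a / (b + 1))\<^sup>2 * b"
      using quad[of "- a / (b + 1)"] by (simp only: a_def)
    also have "\<dots> = - (a\<^sup>2 * (b + 2)) / (b + 1)\<^sup>2"
    proof -
      have "2 * (- a / d) * a + (- a / d)\<^sup>2 * (d - 1) = - (a\<^sup>2 * (d + 1)) / d\<^sup>2" if "d \<noteq> 0" for d
        using that by (simp add: power2_eq_square divide_simps) (simp add: algebra_simps)?
      from this[of "b + 1"] show ?thesis using b by (simp add: add.assoc)
    qed
    also have "\<dots> < 0" using a b by (intro divide_neg_pos) auto
    finally show False by simp
  qed
  then have "A *v x0 = complex_of_real m *s x0"
    by (simp add: u_def of_real_vector_smult)
  moreover have "x0 \<noteq> 0" using x0(1) by auto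
  ultimately have "l \<le> m"
    using l unfolding smallest_eigenvalue_def eigenvalue_def by blast
  moreover have "accretive m A" using min by (simp add: accretive_def q_def)
  ultimately show ?thesis by (rule accretive_mono[rotated])
qed

text \<open>The witness is the orthogonal projection \<open>v v\<^sup>* / \<parallel>v\<parallel>\<^sup>2\<close> onto the line of \<open>v\<close>.\<close>
lemma hermitian_eigenprojection:
  fixes A :: "complex ^ 'n ^ 'n"
  assumes A: "hermitian A" and v: "A *v v = complex_of_real l *s v" "v \<noteq> 0"
  obtains W where "A ** W = l *\<^sub>R W" "W ** A = l *\<^sub>R W" "W ** W = W" "norm W = 1"
proof -
  define n where "n = (norm v)\<^sup>2"
  have n: "0 < n" using v(2) by (simp add: n_def)
  have nn: "(\<Sum>k\<in>UNIV. (cmod (v $ k))\<^sup>2) = n"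
    by (simp add: n_def norm_vec_def L2_set_def sum_nonneg)
  have nv: "(\<Sum>k\<in>UNIV. cnj (v $ k) * v $ k) = complex_of_real n"
    by (simp add: complex_norm_square[symmetric] mult.commute[of "cnj _"] flip: nn)
  define W where "W = (\<chi> i j. v $ i * cnj (v $ j) / complex_of_real n)"
  have Av: "(\<Sum>k\<in>UNIV. A $ i $ k * v $ k) = complex_of_real l * v $ i" for i
    using arg_cong[OF v(1), of "\<lambda>x. x $ i"] by (simp add: matrix_vector_mult_def)
  have vA: "(\<Sum>k\<in>UNIV. cnj (v $ k) * A $ k $ j) = complex_of_real l * cnj (v $ j)" for j
  proof -
    have "A $ k $ j = cnj (A $ j $ k)" for k by (rule A[unfolded hermitian_def, rule_format])
    then have "(\<Sum>k\<in>UNIV. cnj (v $ k) * A $ k $ j) = cnj (\<Sum>k\<in>UNIV. A $ j $ k * v $ k)"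
      by (simp only: cnj_sum complex_cnj_mult mult.commute)
    then show ?thesis by (simp add: Av)
  qed
  have "A ** W = l *\<^sub>R W"
  proof -
    have "(\<Sum>k\<in>UNIV. A $ i $ k * (v $ k * cnj (v $ j) / complex_of_real n))
        = (\<Sum>k\<in>UNIV. A $ i $ k * v $ k) * (cnj (v $ j) / complex_of_real n)" for i j
      by (simp add: sum_distrib_right sum_divide_distrib mult.assoc)
    then show ?thesis
      by (simp add: W_def vec_eq_iff matrix_matrix_mult_def Av scaleR_conv_of_real[where 'a=complex])
  qed
  moreover have "W ** A = l *\<^sub>R W"
  proof -
    have "(\<Sum>k\<in>UNIV. v $ i * cnj (v $ k) / complex_of_real n * A $ k $ j)
        = v $ i / complex_of_real n * (\<Sum>k\<in>UNIV. cnj (v $ k) * A $ k $ j)" for i j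
      by (simp add: sum_distrib_left mult_ac)
    then show ?thesis
      by (simp add: W_def vec_eq_iff matrix_matrix_mult_def vA scaleR_conv_of_real[where 'a=complex])
  qed
  moreover have "W ** W = W"
  proof -
    have "(\<Sum>k\<in>UNIV. v $ i * cnj (v $ k) / complex_of_real n * (v $ k * cnj (v $ j) / complex_of_real n))
        = v $ i * cnj (v $ j) / (complex_of_real n)\<^sup>2 * (\<Sum>k\<in>UNIV. cnj (v $ k) * v $ k)" for i j
      by (simp add: sum_distrib_left sum_divide_distrib power2_eq_square mult_ac)
    then show ?thesis
      using n by (simp add: W_def vec_eq_iff matrix_matrix_mult_def nv power2_eq_square)
  qed
  moreover have "norm W = 1"
  proof -
    have "(\<Sum>i\<in>UNIV. \<Sum>j\<in>UNIV. (cmod (W $ i $ j))\<^sup>2)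
        = (\<Sum>i\<in>UNIV. \<Sum>j\<in>UNIV. (cmod (v $ i))\<^sup>2 * (cmod (v $ j))\<^sup>2 / n\<^sup>2)"
      using n by (simp add: W_def norm_mult norm_divide power_mult_distrib power_divide)
    also have "\<dots> = (\<Sum>i\<in>UNIV. (cmod (v $ i))\<^sup>2) * (\<Sum>j\<in>UNIV. (cmod (v $ j))\<^sup>2) / n\<^sup>2"
      by (simp only: sum_product sum_divide_distrib)
    also have "\<dots> = 1" unfolding nn using n by (simp add: power2_eq_square)
    finally show ?thesis by (simp add: norm_eq_frobenius)
  qed
  ultimately show ?thesis by (rule that)
qed

lemma weighted_measure_if_linear_growth:
  assumes sets: "sets \<mu> = sets (restrict_space borel {0..})"
    and int: "integrable \<mu> (\<lambda>t. 1 / (1 + t))"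
    and cont: "continuous_on {0..} w" and w: "\<And>t. 0 \<le> t \<Longrightarrow> 0 \<le> w t \<and> w t \<le> 1 + t"
  shows "weighted_measure \<mu> w"
proof
  show "integrable \<mu> (\<lambda>t. w t / (1 + t)\<^sup>2)"
  proof (rule integrable_if_continuous_dominated[OF sets int])
    show "continuous_on {0..} (\<lambda>t. w t / (1 + t)\<^sup>2)" by (intro continuous_intros cont) auto
    fix t :: real assume t: "0 \<le> t"
    have "w t / (1 + t)\<^sup>2 \<le> (1 + t) / (1 + t)\<^sup>2"
      using w[OF t] by (intro divide_right_mono) auto
    then show "norm (w t / (1 + t)\<^sup>2) \<le> 1 * (1 / (1 + t))"
      using w[OF t] t by (simp add: power2_eq_square)
  qed
qed (use sets cont w in auto)

theorem corollary8:
  fixes f :: "complex \<Rightarrow> complex" and A :: "complex ^ 'n ^ 'n" and lmin :: real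
  assumes "stieltjes f \<or> (\<exists>g. stieltjes g \<and> (\<forall>z. z \<notin> \<real>\<^sub>\<le>\<^sub>0 \<longrightarrow> f z = z * g z))"
    and "hermitian_posdef A"
    and "smallest_eigenvalue A lmin"
    and "simple_eigenvalue A (complex_of_real lmin)"
  shows "cond_abs2_exists f A \<and>
         cond_abs2 f A = ereal (cmod ((deriv ^^ 2) f (complex_of_real lmin)))"
proof -
  have herm: "hermitian A" using assms(2) by (simp add: hermitian_posdef_def)
  have acc: "accretive lmin A"
    by (rule hermitian_accretive_smallest_eigenvalue[OF herm assms(3)])
  obtain v where v: "v \<noteq> 0" "A *v v = complex_of_real lmin *s v"
    using assms(3) unfolding smallest_eigenvalue_def eigenvalue_def by blast
  have "0 < v \<bullet> (A *v v)"
    using assms(2) v(1) by (simp add: hermitian_posdef_def inner_eq_Re_form)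
  then have "0 < lmin * (v \<bullet> v)" by (simp add: v(2) of_real_vector_smult)
  then have l: "0 < lmin"
    by (rule zero_less_mult_pos2) (simp add: v(1))
  obtain W where W: "A ** W = lmin *\<^sub>R W" "W ** A = lmin *\<^sub>R W" "W ** W = W" "norm W = 1"
    using hermitian_eigenprojection[OF herm v(2,1)] by blast
  from assms(1) show ?thesis
  proof
    assume "stieltjes f"
    then obtain \<mu> where sets: "sets \<mu> = sets (restrict_space borel {0::real..})"
      and int0: "integrable \<mu> (\<lambda>t. 1 / (1 + t))"
      and i: "\<And>z. 0 < Re z \<Longrightarrow> integrable \<mu> (\<lambda>t. 1 / (complex_of_real t + z))"
      and f: "\<And>z. 0 < Re z \<Longrightarrow> f z = (LINT t|\<mu>. 1 / (complex_of_real t + z))"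
      using stieltjes_measureE by blast
    interpret weighted_measure \<mu> "\<lambda>_. 1"
      by (rule weighted_measure_if_linear_growth[OF sets int0]) auto
    have "cond_abs2_exists f A \<and> cond_abs2 f A = ereal (2 * moment \<mu> (\<lambda>_. 1) lmin 3)"
    proof (rule cond_abs2_eq_moment[where s = 1, OF _ _ acc l W])
      fix c and X Y :: "complex ^ 'n ^ 'n" assume c: "0 < c" "accretive c X" "accretive c Y"
      note X = mat_fun_stieltjes[OF sets int0 f c(2,1)] and Y = mat_fun_stieltjes[OF sets int0 f c(3,1)]
      show "mat_fun f Y - mat_fun f X = 1 *\<^sub>R (LINT t|\<mu>. 1 *\<^sub>R (resolvent Y t - resolvent X t))"
        by (simp add: X(1,2) Y(1,2))
    qed simp
    moreover have "cmod ((deriv ^^ 2) f (complex_of_real lmin)) = 2 * moment \<mu> (\<lambda>_. 1) lmin 3"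
    proof (rule cmod_deriv2_eq_moment[where s = 1, OF _ _ l])
      show "f z = f 1 + 1 * (LINT t|\<mu>. complex_of_real 1 *
          (1 / (complex_of_real t + z) - 1 / (complex_of_real t + 1)))" if "0 < Re z" for z
        using i[OF that] i[of 1] f[of 1] f[OF that] by simp
    qed simp
    ultimately show ?thesis by simp
  next
    assume "\<exists>g. stieltjes g \<and> (\<forall>z. z \<notin> \<real>\<^sub>\<le>\<^sub>0 \<longrightarrow> f z = z * g z)"
    then obtain g where g: "stieltjes g" and "\<And>z. z \<notin> \<real>\<^sub>\<le>\<^sub>0 \<Longrightarrow> f z = z * g z" by blast
    then have fg: "f z = z * g z" if "0 < Re z" for z
      using that by (auto simp: complex_nonpos_Reals_iff)
    from g obtain \<mu> where sets: "sets \<mu> = sets (restrict_space borel {0::real..})"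
      and int0: "integrable \<mu> (\<lambda>t. 1 / (1 + t))"
      and i: "\<And>z. 0 < Re z \<Longrightarrow> integrable \<mu> (\<lambda>t. 1 / (complex_of_real t + z))"
      and g: "\<And>z. 0 < Re z \<Longrightarrow> g z = (LINT t|\<mu>. 1 / (complex_of_real t + z))"
      using stieltjes_measureE by blast
    interpret weighted_measure \<mu> "\<lambda>t. t"
      by (rule weighted_measure_if_linear_growth[OF sets int0]) auto
    have "cond_abs2_exists f A \<and> cond_abs2 f A = ereal (2 * moment \<mu> (\<lambda>t. t) lmin 3)"
    proof (rule cond_abs2_eq_moment[where s = "- 1", OF _ _ acc l W])
      fix c and X Y :: "complex ^ 'n ^ 'n" assume c: "0 < c" "accretive c X" "accretive c Y"
      have V: "integrable \<mu> (resolvent V)" "mat_fun f V = V ** (LINT t|\<mu>. resolvent V t)"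
        if "accretive c V" for V :: "complex ^ 'n ^ 'n"
        using mat_fun_stieltjes(1)[OF sets int0 _ that c(1), of g]
          mat_fun_stieltjes(3)[OF sets int0 _ that c(1), of g f] g fg by auto
      have mult: "bounded_linear ((**) M)" for M :: "complex ^ 'n ^ 'n"
        by (rule matrix_mult.bounded_linear_right)
      have "mat_fun f Y - mat_fun f X
          = (LINT t|\<mu>. Y ** resolvent Y t) - (LINT t|\<mu>. X ** resolvent X t)"
        unfolding V(2)[OF c(2)] V(2)[OF c(3)]
        by (simp only: integral_bounded_linear[OF mult V(1)[OF c(2)]]
            integral_bounded_linear[OF mult V(1)[OF c(3)]])
      also have "\<dots> = (LINT t|\<mu>. Y ** resolvent Y t - X ** resolvent X t)"
        using integrable_bounded_linear[OF mult V(1)[OF c(2)]]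
          integrable_bounded_linear[OF mult V(1)[OF c(3)]] by simp
      also have "\<dots> = (LINT t|\<mu>. (- 1) *\<^sub>R (t *\<^sub>R (resolvent Y t - resolvent X t)))"
      proof (rule Bochner_Integration.integral_cong[OF refl])
        fix t assume "t \<in> space \<mu>"
        then have t: "0 < t + c" using c by (simp add: space_iff)
        have R: "V ** resolvent V t = mat 1 - t *\<^sub>R resolvent V t" if "accretive c V" for V :: "complex ^ 'n ^ 'n"
          using resolvent_mult(2)[OF that t]
          by (simp add: matrix_mult.add_left mat_of_real_mult eq_diff_eq add.commute)
        show "Y ** resolvent Y t - X ** resolvent X t = (- 1) *\<^sub>R (t *\<^sub>R (resolvent Y t - resolvent X t))"
          by (simp add: R c scaleR_diff_right)
      qed
      finally show "mat_fun f Y - mat_fun f X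
          = (- 1) *\<^sub>R (LINT t|\<mu>. t *\<^sub>R (resolvent Y t - resolvent X t))" by simp
    qed simp
    moreover have "cmod ((deriv ^^ 2) f (complex_of_real lmin)) = 2 * moment \<mu> (\<lambda>t. t) lmin 3"
    proof (rule cmod_deriv2_eq_moment[where s = "- 1", OF _ _ l])
      fix z assume z: "0 < Re z"
      have "f z - f 1 = (LINT t|\<mu>. z * (1 / (complex_of_real t + z)) - 1 * (1 / (complex_of_real t + 1)))"
        using Bochner_Integration.integral_diff[OF integrable_mult_right[OF i[OF z], of z]
            integrable_mult_right[OF i, of 1 1]] fg[OF z] fg[of 1] g[OF z] g[of 1]
        by (simp only: integral_mult_right_zero one_complex.sel zero_less_one simp_thms)
      also have "\<dots> = (LINT t|\<mu>. - (complex_of_real t * (1 / (complex_of_real t + z) - 1 / (complex_of_real t + 1))))"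
      proof (rule Bochner_Integration.integral_cong[OF refl])
        fix t assume "t \<in> space \<mu>"
        then have "complex_of_real t + z \<noteq> 0" "complex_of_real t + 1 \<noteq> 0"
          using z shift_nonzero[of t z] shift_nonzero[of t 1] by (auto simp: space_iff)
        then show "z * (1 / (complex_of_real t + z)) - 1 * (1 / (complex_of_real t + 1))
            = - (complex_of_real t * (1 / (complex_of_real t + z) - 1 / (complex_of_real t + 1)))"
          by (simp add: divide_simps) (simp add: algebra_simps)
      qed
      finally show "f z = f 1 + - 1 * (LINT t|\<mu>. complex_of_real t *
          (1 / (complex_of_real t + z) - 1 / (complex_of_real t + 1)))"
        by (simp only: Bochner_Integration.integral_minus) (simp add: diff_eq_eq)
    qed simp
    ultimately show ?thesis by simp
  qed
qed

end
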